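(* Let $a_0\in\mathbb{D}$, $a_1,b\in\mathbb{C}$, $\psi(z)=\frac{b}{1-a_0z}$ and $\varphi(z)=a_0+\frac{a_1z}{1-a_0z}$, where $\varphi$ is an analytic self-map of $\mathbb{D}$. Let $p\in\mathbb{D}\setminus\{0\}$, $|c|=1$, $\varphi_p(z)=\frac{\overline{p}}{p}\frac{p-z}{1-\overline{p}z}$, $\psi_p(z)=c\frac{(1-|p|^2)^{1/2}}{1-\overline{p}z}$, and put $\widetilde\psi=\psi_p\cdot(\psi\circ\varphi_p)$, $\widetilde\varphi=\varphi\circ\varphi_p$. Suppose that $\widetilde\varphi$ is not an automorphism of $\mathbb{D}$. If $\varphi$ and $\varphi_p$ both fix $1$, then $\varphi$, $\varphi_p$ and $\widetilde\varphi$ are parabolic, $$r(C_{\widetilde\psi,\widetilde\varphi})=\left|\frac{\psi(0)(1-|p|^2)^{1/2}(2+t)}{2(1-\overline{p})}\right|,$$ and $$\sigma(C_{\widetilde\psi,\widetilde\varphi})=\left\{\frac{\psi(0)(1-|p|^2)^{1/2}(2+t)}{2(1-\overline{p})}\,e^{-s(t+\widetilde t)} : s\ge 0\right\}\cup\{0\},$$ where $t$ and $\widetilde t$ are the translation numbers of $\varphi$ and $\varphi_p$, respectively.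
   Context: $\mathbb{D}$ is the open unit disk and $H^2$ is the Hardy space on $\mathbb{D}$. $(C_{\psi,\varphi}f)(z)=\psi(z)f(\varphi(z))$ is the weighted composition operator, acting on $H^2$. $\sigma(T)$ and $r(T)$ denote the spectrum and spectral radius of $T$. A linear-fractional self-map of $\mathbb{D}$ is parabolic if it has exactly one fixed point in the Riemann sphere and this fixed point $\zeta$ lies on $\partial\mathbb{D}$; in that case, with $T(z)=\frac{\zeta+z}{\zeta-z}$, one has $(T\circ\varphi\circ T^{-1})(z)=z+t$ with $\mathrm{Re}(t)\ge0$, and $t$ is called the translation number of $\varphi$.
   Formalization: The spectrum formula carries an extra factor c (the unimodular constant in ψ_p), omitted in the printed formula; as printed it is false when c≠1 and b≠0, and the two agree when c=1 or b=0. *)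

theory Defs
  imports "HOL-Complex_Analysis.Complex_Analysis"
begin

abbreviation unit_disc :: "complex set" where
  "unit_disc \<equiv> ball 0 1"

section \<open>Linear-fractional self-maps of the disc\<close>

definition disc_self_map :: "(complex \<Rightarrow> complex) \<Rightarrow> bool" where
  "disc_self_map f \<longleftrightarrow> f holomorphic_on unit_disc \<and> f ` unit_disc \<subseteq> unit_disc"

definition disc_automorphism :: "(complex \<Rightarrow> complex) \<Rightarrow> bool" where
  "disc_automorphism f \<longleftrightarrow> f holomorphic_on unit_disc \<and> bij_betw f unit_disc unit_disc"

text \<open>The Riemann sphere is modelled by \<^typ>\<open>complex option\<close>, with \<^term>\<open>None\<close> as the
  point at infinity.\<close>

definition sphere_map ::
  "complex \<Rightarrow> complex \<Rightarrow> complex \<Rightarrow> complex \<Rightarrow> complex option \<Rightarrow> complex option" where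
  "sphere_map \<alpha> \<beta> \<gamma> \<delta> x = (case x of
      None \<Rightarrow> if \<gamma> = 0 then None else Some (\<alpha> / \<gamma>)
    | Some z \<Rightarrow> if \<gamma> * z + \<delta> = 0 then None else Some ((\<alpha> * z + \<beta>) / (\<gamma> * z + \<delta>)))"

text \<open>Only the values of \<open>f\<close> on the disc matter: they determine the coefficients up to a common
  factor, hence also the extension of \<open>f\<close> to the sphere.\<close>

definition parabolic_at :: "(complex \<Rightarrow> complex) \<Rightarrow> complex \<Rightarrow> bool" where
  "parabolic_at f \<zeta> \<longleftrightarrow> disc_self_map f \<and> cmod \<zeta> = 1 \<and>
     (\<exists>\<alpha> \<beta> \<gamma> \<delta>. \<alpha> * \<delta> - \<beta> * \<gamma> \<noteq> 0 \<and>
        (\<forall>z\<in>unit_disc. sphere_map \<alpha> \<beta> \<gamma> \<delta> (Some z) = Some (f z)) \<and>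
        {x. sphere_map \<alpha> \<beta> \<gamma> \<delta> x = x} = {Some \<zeta>})"

definition parabolic :: "(complex \<Rightarrow> complex) \<Rightarrow> bool" where
  "parabolic f \<longleftrightarrow> (\<exists>\<zeta>. parabolic_at f \<zeta>)"

definition half_plane_map :: "complex \<Rightarrow> complex \<Rightarrow> complex" where
  "half_plane_map \<zeta> z = (\<zeta> + z) / (\<zeta> - z)"

text \<open>\<^term>\<open>half_plane_map \<zeta>\<close> maps the disc bijectively onto the right half-plane, which is
  therefore the domain of the conjugated map.\<close>

definition translation_number :: "(complex \<Rightarrow> complex) \<Rightarrow> complex" where
  "translation_number f = (THE t. \<exists>\<zeta>. parabolic_at f \<zeta> \<and>
     (\<forall>w. 0 < Re w \<longrightarrow>
        (half_plane_map \<zeta> \<circ> f \<circ> inv_into unit_disc (half_plane_map \<zeta>)) w = w + t))"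

section \<open>The Hardy space and its operators\<close>

definition taylor_coeff :: "(complex \<Rightarrow> complex) \<Rightarrow> nat \<Rightarrow> complex" where
  "taylor_coeff f n = (deriv ^^ n) f 0 / fact n"

text \<open>Functions on the disc are represented by total functions vanishing outside the disc, so
  that equality of elements of \<open>H2\<close> is equality of functions.\<close>

definition H2 :: "(complex \<Rightarrow> complex) set" where
  "H2 = {f. f holomorphic_on unit_disc \<and> (\<forall>z. z \<notin> unit_disc \<longrightarrow> f z = 0) \<and>
            summable (\<lambda>n. (cmod (taylor_coeff f n))\<^sup>2)}"

definition H2_norm :: "(complex \<Rightarrow> complex) \<Rightarrow> real" where
  "H2_norm f = sqrt (\<Sum>n. (cmod (taylor_coeff f n))\<^sup>2)"

definition H2_bounded_operator ::
  "((complex \<Rightarrow> complex) \<Rightarrow> (complex \<Rightarrow> complex)) \<Rightarrow> bool" where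
  "H2_bounded_operator S \<longleftrightarrow>
     (\<forall>f\<in>H2. S f \<in> H2) \<and>
     (\<forall>f\<in>H2. \<forall>g\<in>H2. S (\<lambda>z. f z + g z) = (\<lambda>z. S f z + S g z)) \<and>
     (\<forall>k. \<forall>f\<in>H2. S (\<lambda>z. k * f z) = (\<lambda>z. k * S f z)) \<and>
     (\<exists>K. \<forall>f\<in>H2. H2_norm (S f) \<le> K * H2_norm f)"

definition H2_spectrum ::
  "((complex \<Rightarrow> complex) \<Rightarrow> (complex \<Rightarrow> complex)) \<Rightarrow> complex set" where
  "H2_spectrum T = {l. \<not> (\<exists>S. H2_bounded_operator S \<and>
     (\<forall>f\<in>H2. S (\<lambda>z. T f z - l * f z) = f) \<and>
     (\<forall>f\<in>H2. (\<lambda>z. T (S f) z - l * S f z) = f))}"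

definition H2_spectral_radius ::
  "((complex \<Rightarrow> complex) \<Rightarrow> (complex \<Rightarrow> complex)) \<Rightarrow> real" where
  "H2_spectral_radius T = (SUP l\<in>H2_spectrum T. cmod l)"

definition weighted_comp ::
  "(complex \<Rightarrow> complex) \<Rightarrow> (complex \<Rightarrow> complex) \<Rightarrow> (complex \<Rightarrow> complex) \<Rightarrow> (complex \<Rightarrow> complex)" where
  "weighted_comp \<psi> \<phi> f = (\<lambda>z. if z \<in> unit_disc then \<psi> z * f (\<phi> z) else 0)"

end

theory Submission
  imports Defs "HOL-Probability.Distributions"
begin

text \<open>Put \<open>w = (1 + z) / (1 - z)\<close>. The composed map becomes \<open>w \<mapsto> w + \<tau>\<close> with \<open>\<tau> = t + t'\<close>, and the
  weight is \<open>C (1 - \<phi>' z) / (1 - z)\<close> for a constant \<open>C\<close>; hence \<open>f z = F w / (1 - z)\<close> is mapped to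
  \<open>C F (w + \<tau>) / (1 - z)\<close>. Writing \<open>F\<close> as the Laplace transform of a function in \<open>L\<^sup>2(0, \<infinity>)\<close>, the
  operator is multiplication by \<open>C exp (- x \<tau>)\<close>, whose spectrum is the closure of the values of this
  symbol because \<open>Re \<tau> > 0\<close>.\<close>

section \<open>Square-integrable functions\<close>

text \<open>Why Re \<open>\<tau>\<close> > 0: fixing 1 makes the translation number of
  \<open>\<phi>p\<close> imaginary; if that of \<open>\<phi>\<close> were imaginary too, the
  composed map would translate the half-plane onto itself and be an automorphism. The Paley-Wiener
  isomorphism is replaced by coefficients. Laguerre coefficients send L2 of the half-line
  contractively into l2, which is H2 through Taylor coefficients, and Parseval's identity is proved
  only for the kernels representing point evaluations; these suffice to recognise the operator. All
  pairings are bilinear rather than Hermitian: the kernels then depend holomorphically on the point,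
  and multiplication operators have symmetric matrices, so that inverses can be transferred by
  transposition. Since Bessel's inequality bounds coefficients only from above, showing that a point
  lies in the spectrum takes a lower bound for one explicit coefficient of a test function.\<close>

lemma cmod_add_sq_le:
  "(cmod (a + b))\<^sup>2 \<le> 2 * (cmod a)\<^sup>2 + 2 * (cmod b)\<^sup>2"
  using power_mono[OF norm_triangle_ineq[of a b], of 2] sum_squares_bound[of "cmod a" "cmod b"]
  by (simp add: power2_sum)

definition sq_integrable :: "'a measure \<Rightarrow> ('a \<Rightarrow> complex) \<Rightarrow> bool" where
  "sq_integrable M g \<longleftrightarrow> g \<in> borel_measurable M \<and> integrable M (\<lambda>x. (cmod (g x))\<^sup>2)"

definition sq_norm :: "'a measure \<Rightarrow> ('a \<Rightarrow> complex) \<Rightarrow> real" where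
  "sq_norm M g = (LINT x|M. (cmod (g x))\<^sup>2)"

definition pairing :: "'a measure \<Rightarrow> ('a \<Rightarrow> complex) \<Rightarrow> ('a \<Rightarrow> complex) \<Rightarrow> complex" where
  "pairing M g h = (LINT x|M. g x * h x)"

lemma sq_norm_nonneg: "0 \<le> sq_norm M g"
  by (simp add: sq_norm_def)

lemma pairing_commute: "pairing M g h = pairing M h g"
  by (simp add: pairing_def mult.commute)

lemma integrable_mult_sq_integrable:
  assumes "sq_integrable M g" "sq_integrable M h"
  shows "integrable M (\<lambda>x. g x * h x)"
proof (rule Bochner_Integration.integrable_bound)
  show "integrable M (\<lambda>x. (cmod (g x))\<^sup>2 + (cmod (h x))\<^sup>2)"
    using assms by (auto simp: sq_integrable_def)
  show "(\<lambda>x. g x * h x) \<in> borel_measurable M"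
    using assms by (auto simp: sq_integrable_def)
  have "a * b \<le> a\<^sup>2 + b\<^sup>2" for a b :: real
    using sum_squares_bound[of a b] zero_le_power2[of a] zero_le_power2[of b] by linarith
  then show "AE x in M. norm (g x * h x) \<le> norm ((cmod (g x))\<^sup>2 + (cmod (h x))\<^sup>2)"
    by (auto simp: norm_mult)
qed

lemma sq_integrable_add:
  assumes "sq_integrable M g" "sq_integrable M h"
  shows "sq_integrable M (\<lambda>x. g x + h x)"
  unfolding sq_integrable_def
proof
  show m: "(\<lambda>x. g x + h x) \<in> borel_measurable M"
    using assms by (auto simp: sq_integrable_def)
  show "integrable M (\<lambda>x. (cmod (g x + h x))\<^sup>2)"
  proof (rule Bochner_Integration.integrable_bound)
    show "integrable M (\<lambda>x. 2 * (cmod (g x))\<^sup>2 + 2 * (cmod (h x))\<^sup>2)"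
      using assms by (auto simp: sq_integrable_def)
    show "(\<lambda>x. (cmod (g x + h x))\<^sup>2) \<in> borel_measurable M"
      using m by measurable
    show "AE x in M. norm ((cmod (g x + h x))\<^sup>2) \<le> norm (2 * (cmod (g x))\<^sup>2 + 2 * (cmod (h x))\<^sup>2)"
      using cmod_add_sq_le by auto
  qed
qed

lemma sq_integrable_mult_bounded:
  assumes "sq_integrable M g" "h \<in> borel_measurable M" "\<And>x. x \<in> space M \<Longrightarrow> cmod (h x) \<le> B"
  shows "sq_integrable M (\<lambda>x. h x * g x)" "sq_norm M (\<lambda>x. h x * g x) \<le> B\<^sup>2 * sq_norm M g"
proof -
  have le: "(cmod (h x * g x))\<^sup>2 \<le> B\<^sup>2 * (cmod (g x))\<^sup>2" if "x \<in> space M" for x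
    using assms(3)[OF that] by (auto simp: norm_mult power_mult_distrib intro!: mult_right_mono power_mono)
  have i: "integrable M (\<lambda>x. B\<^sup>2 * (cmod (g x))\<^sup>2)"
    using assms by (auto simp: sq_integrable_def)
  have m: "(\<lambda>x. h x * g x) \<in> borel_measurable M"
    using assms by (auto simp: sq_integrable_def)
  have j: "integrable M (\<lambda>x. (cmod (h x * g x))\<^sup>2)"
    by (rule Bochner_Integration.integrable_bound[OF i]) (use m le in auto)
  show "sq_integrable M (\<lambda>x. h x * g x)"
    using m j by (simp add: sq_integrable_def)
  have "sq_norm M (\<lambda>x. h x * g x) \<le> (LINT x|M. B\<^sup>2 * (cmod (g x))\<^sup>2)"
    unfolding sq_norm_def by (rule integral_mono[OF j i le])
  then show "sq_norm M (\<lambda>x. h x * g x) \<le> B\<^sup>2 * sq_norm M g"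
    by (simp add: sq_norm_def)
qed

lemma sq_integrable_cmult: "sq_integrable M g \<Longrightarrow> sq_integrable M (\<lambda>x. k * g x)"
  by (rule sq_integrable_mult_bounded(1)[where B = "cmod k"]) auto

lemma sq_integrable_diff:
  assumes "sq_integrable M g" "sq_integrable M h"
  shows "sq_integrable M (\<lambda>x. g x - h x)"
  using sq_integrable_add[OF assms(1) sq_integrable_cmult[OF assms(2), of "-1"]] by simp

lemma sq_integrable_zero: "sq_integrable M (\<lambda>x. 0)"
  by (simp add: sq_integrable_def)

lemma sq_integrable_sum:
  "(\<And>i. i \<in> I \<Longrightarrow> sq_integrable M (g i)) \<Longrightarrow> sq_integrable M (\<lambda>x. \<Sum>i\<in>I. g i x)"
  by (induction I rule: infinite_finite_induct) (auto simp: sq_integrable_zero sq_integrable_add)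

lemma sq_integrable_cnj: "sq_integrable M g \<Longrightarrow> sq_integrable M (\<lambda>x. cnj (g x))"
  unfolding sq_integrable_def
  by (auto intro!: measurable_compose[OF _ borel_measurable_continuous_onI, of g M cnj] continuous_intros)

lemma pairing_cmult_left: "pairing M (\<lambda>x. k * g x) h = k * pairing M g h"
  by (simp add: pairing_def mult.assoc)

lemma pairing_cmult_right: "pairing M g (\<lambda>x. k * h x) = k * pairing M g h"
  using pairing_cmult_left[of M k h g] by (simp add: pairing_commute)

lemma pairing_diff_left:
  assumes "sq_integrable M g" "sq_integrable M g'" "sq_integrable M h"
  shows "pairing M (\<lambda>x. g x - g' x) h = pairing M g h - pairing M g' h"
  using integrable_mult_sq_integrable[OF assms(1,3)] integrable_mult_sq_integrable[OF assms(2,3)]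
  by (simp add: pairing_def algebra_simps)

lemma pairing_sum_left:
  assumes "\<And>i. i \<in> I \<Longrightarrow> sq_integrable M (g i)" "sq_integrable M h"
  shows "pairing M (\<lambda>x. \<Sum>i\<in>I. k i * g i x) h = (\<Sum>i\<in>I. k i * pairing M (g i) h)"
proof -
  have "pairing M (\<lambda>x. \<Sum>i\<in>I. k i * g i x) h = (LINT x|M. (\<Sum>i\<in>I. k i * (g i x * h x)))"
    by (simp add: pairing_def sum_distrib_right mult.assoc)
  also have "\<dots> = (\<Sum>i\<in>I. k i * pairing M (g i) h)"
    using integrable_mult_sq_integrable[OF assms(1) assms(2)]
    by (subst Bochner_Integration.integral_sum) (auto simp: pairing_def)
  finally show ?thesis .
qed

lemma Cauchy_Schwarz_pairing:
  assumes "sq_integrable M g" "sq_integrable M h"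
  shows "(cmod (pairing M g h))\<^sup>2 \<le> sq_norm M g * sq_norm M h"
proof -
  have [measurable]: "g \<in> borel_measurable M" "h \<in> borel_measurable M"
    using assms by (auto simp: sq_integrable_def)
  have sq: "(\<integral>\<^sup>+ x. (ennreal (cmod (f x)))\<^sup>2 \<partial>M) = ennreal (sq_norm M f)" if "sq_integrable M f" for f
    using that unfolding sq_norm_def sq_integrable_def
    by (subst nn_integral_eq_integral[symmetric]) (auto simp: ennreal_power)
  define I where "I = (LINT x|M. cmod (g x * h x))"
  have I: "(\<integral>\<^sup>+ x. ennreal (cmod (g x)) * ennreal (cmod (h x)) \<partial>M) = ennreal I"
    using integrable_norm[OF integrable_mult_sq_integrable[OF assms]] unfolding I_def
    by (subst nn_integral_eq_integral[symmetric]) (auto simp: norm_mult ennreal_mult)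
  have I0: "I \<ge> 0" by (simp add: I_def)
  have "(ennreal I)\<^sup>2 \<le> ennreal (sq_norm M g) * ennreal (sq_norm M h)"
    using Cauchy_Schwarz_nn_integral[of "\<lambda>x. ennreal (cmod (g x))" M "\<lambda>x. ennreal (cmod (h x))"]
    unfolding I sq[OF assms(1)] sq[OF assms(2)] by simp
  then have "ennreal (I\<^sup>2) \<le> ennreal (sq_norm M g * sq_norm M h)"
    by (simp add: ennreal_mult sq_norm_nonneg ennreal_power I0)
  then have "I\<^sup>2 \<le> sq_norm M g * sq_norm M h"
    by (simp add: sq_norm_nonneg)
  moreover have "cmod (pairing M g h) \<le> I"
    unfolding pairing_def I_def by (rule integral_norm_bound)
  ultimately show ?thesis
    by (meson norm_ge_zero order_trans power_mono)
qed

text \<open>One step of Pythagoras. As \<open>e\<close> is real, the bilinear pairing with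
  \<open>e\<close> is also the Hermitian one, so the two cross terms are both the product of the
  coefficient and its conjugate.\<close>

lemma sq_norm_diff_projection:
  assumes "sq_integrable M g" "sq_integrable M e"
    and real: "\<And>x. cnj (e x) = e x" and unit: "pairing M e e = 1"
  shows "sq_norm M (\<lambda>x. g x - pairing M g e * e x) = sq_norm M g - (cmod (pairing M g e))\<^sup>2"
proof -
  define c where "c = pairing M g e"
  have i: "integrable M (\<lambda>x. g x * cnj (g x))" "integrable M (\<lambda>x. g x * e x)"
     "integrable M (\<lambda>x. e x * cnj (g x))" "integrable M (\<lambda>x. e x * e x)"
    using assms by (intro integrable_mult_sq_integrable sq_integrable_cnj; simp)+
  have cn: "complex_of_real (sq_norm M f) = (LINT x|M. f x * cnj (f x))" for f
    unfolding sq_norm_def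
    by (subst integral_complex_of_real[symmetric]) (simp add: complex_norm_square del: of_real_power)
  have cc: "(LINT x|M. e x * cnj (g x)) = cnj c"
    unfolding c_def pairing_def
    by (subst Bochner_Integration.integral_cnj[symmetric]) (simp add: real mult.commute)
  have "complex_of_real (sq_norm M (\<lambda>x. g x - c * e x))
      = (LINT x|M. g x * cnj (g x) - cnj c * (g x * e x) - c * (e x * cnj (g x)) + c * cnj c * (e x * e x))"
    unfolding cn by (simp add: real algebra_simps)
  also have "\<dots> = (LINT x|M. g x * cnj (g x)) - cnj c * (LINT x|M. g x * e x)
      - c * (LINT x|M. e x * cnj (g x)) + c * cnj c * (LINT x|M. e x * e x)"
    using i by simp
  also have "\<dots> = (LINT x|M. g x * cnj (g x)) - cnj c * c - c * cnj c + c * cnj c * 1"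
    using unit cc by (simp add: c_def pairing_def)
  also have "\<dots> = complex_of_real (sq_norm M g - (cmod c)\<^sup>2)"
    by (simp add: cn complex_norm_square mult.commute del: of_real_power)
  finally show ?thesis
    unfolding c_def of_real_eq_iff .
qed

text \<open>Real values turn \<open>pairing M g (e n)\<close> into a Hermitian Fourier coefficient,
  which makes the Hilbert-space inequalities available for the bilinear pairing.\<close>

locale real_orthonormal =
  fixes M :: "'a measure" and e :: "nat \<Rightarrow> 'a \<Rightarrow> complex"
  assumes sq_integrable_e: "sq_integrable M (e n)"
    and cnj_e: "cnj (e n x) = e n x"
    and orthonormal: "pairing M (e m) (e n) = (if m = n then 1 else 0)"
begin

definition coef :: "('a \<Rightarrow> complex) \<Rightarrow> nat \<Rightarrow> complex" where
  "coef g n = pairing M g (e n)"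

lemma coef_e: "coef (e m) n = (if n = m then 1 else 0)"
  by (auto simp: coef_def orthonormal)

text \<open>One coordinate is removed at a time: by orthogonality the remainder after N steps still
  has \<open>coef g N\<close> as its coefficient at N.\<close>

lemma sq_norm_diff_partial_sum:
  assumes "sq_integrable M g"
  shows "sq_norm M (\<lambda>x. g x - (\<Sum>n<N. coef g n * e n x)) = sq_norm M g - (\<Sum>n<N. (cmod (coef g n))\<^sup>2)"
proof (induction N)
  case (Suc N)
  let ?r = "\<lambda>x. g x - (\<Sum>n<N. coef g n * e n x)"
  have s: "sq_integrable M (\<lambda>x. \<Sum>n<N. coef g n * e n x)"
    by (intro sq_integrable_sum sq_integrable_cmult sq_integrable_e)
  have "pairing M ?r (e N) = coef g N - (\<Sum>n<N. coef g n * pairing M (e n) (e N))"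
    by (subst pairing_diff_left[OF assms s sq_integrable_e], subst pairing_sum_left)
       (auto simp: sq_integrable_e coef_def)
  also have "(\<Sum>n<N. coef g n * pairing M (e n) (e N)) = 0"
    by (intro sum.neutral) (auto simp: orthonormal)
  finally have p: "pairing M ?r (e N) = coef g N" by simp
  show ?case
    using sq_norm_diff_projection[OF sq_integrable_diff[OF assms s] sq_integrable_e[of N] cnj_e]
    unfolding p by (simp add: orthonormal Suc diff_diff_add)
qed simp

lemma Bessel: "sq_integrable M g \<Longrightarrow> (\<Sum>n<N. (cmod (coef g n))\<^sup>2) \<le> sq_norm M g"
  using sq_norm_diff_partial_sum[of g N]
    sq_norm_nonneg[of M "\<lambda>x. g x - (\<Sum>n<N. coef g n * e n x)"] by simp

lemma summable_coef: 
  assumes "sq_integrable M g"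
  shows "summable (\<lambda>n. (cmod (coef g n))\<^sup>2)" "(\<Sum>n. (cmod (coef g n))\<^sup>2) \<le> sq_norm M g"
proof -
  show s: "summable (\<lambda>n. (cmod (coef g n))\<^sup>2)"
    by (rule summableI_nonneg_bounded[OF _ Bessel[OF assms]]) auto
  show "(\<Sum>n. (cmod (coef g n))\<^sup>2) \<le> sq_norm M g"
    by (rule suminf_le_const[OF s Bessel[OF assms]])
qed

lemma sq_norm_finite_combination: "sq_norm M (\<lambda>x. \<Sum>k<N. a k * e k x) = (\<Sum>k<N. (cmod (a k))\<^sup>2)"
proof -
  let ?g = "\<lambda>x. \<Sum>k<N. a k * e k x"
  have s: "sq_integrable M ?g"
    by (intro sq_integrable_sum sq_integrable_cmult sq_integrable_e)
  have "coef ?g n = (\<Sum>k<N. if k = n then a k else 0)" for n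
    unfolding coef_def
    by (subst pairing_sum_left) (auto simp: sq_integrable_e orthonormal if_distrib intro!: sum.cong cong: if_cong)
  then have c: "coef ?g n = a n" if "n < N" for n
    using that by simp
  have "sq_norm M (\<lambda>x. ?g x - (\<Sum>n<N. coef ?g n * e n x)) = 0"
    by (simp add: c sq_norm_def)
  then show ?thesis
    using sq_norm_diff_partial_sum[OF s, of N] by (simp add: c)
qed

text \<open>Parseval's identity for f alone makes its expansion converge in norm, and Cauchy-Schwarz
  transfers this to the pairing with an arbitrary g. It is applied with an evaluation kernel as
  f.\<close>

lemma pairing_sums_of_Parseval:
  assumes f: "sq_integrable M f" and parseval: "(\<lambda>n. (cmod (coef f n))\<^sup>2) sums sq_norm M f"
    and g: "sq_integrable M g"
  shows "(\<lambda>n. coef f n * coef g n) sums pairing M g f"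
proof -
  let ?p = "\<lambda>N x. \<Sum>n<N. coef f n * e n x"
  have p: "sq_integrable M (?p N)" for N
    by (intro sq_integrable_sum sq_integrable_cmult sq_integrable_e)
  have "(\<lambda>N. (sq_norm M f - (\<Sum>n<N. (cmod (coef f n))\<^sup>2)) * sq_norm M g) \<longlonglongrightarrow> (sq_norm M f - sq_norm M f) * sq_norm M g"
    using parseval unfolding sums_def by (intro tendsto_intros)
  then have 0: "(\<lambda>N. (sq_norm M f - (\<Sum>n<N. (cmod (coef f n))\<^sup>2)) * sq_norm M g) \<longlonglongrightarrow> 0" by simp
  have *: "pairing M g f - (\<Sum>n<N. coef f n * coef g n) = pairing M (\<lambda>x. f x - ?p N x) g" for N
    by (subst pairing_diff_left[OF f p g], subst pairing_sum_left)
       (auto simp: sq_integrable_e g coef_def pairing_commute[of M g])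
  have "(\<lambda>N. (cmod (pairing M g f - (\<Sum>n<N. coef f n * coef g n)))\<^sup>2) \<longlonglongrightarrow> 0"
  proof (rule tendsto_sandwich[OF _ _ tendsto_const 0])
    show "\<forall>\<^sub>F N in sequentially. (cmod (pairing M g f - (\<Sum>n<N. coef f n * coef g n)))\<^sup>2
      \<le> (sq_norm M f - (\<Sum>n<N. (cmod (coef f n))\<^sup>2)) * sq_norm M g"
      using Cauchy_Schwarz_pairing[OF sq_integrable_diff[OF f p] g]
      unfolding * sq_norm_diff_partial_sum[OF f] by auto
  qed auto
  then have "(\<lambda>N. sqrt ((cmod (pairing M g f - (\<Sum>n<N. coef f n * coef g n)))\<^sup>2)) \<longlonglongrightarrow> sqrt 0"
    by (rule tendsto_real_sqrt)
  then have "(\<lambda>N. pairing M g f - (\<Sum>n<N. coef f n * coef g n)) \<longlonglongrightarrow> 0"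
    by (simp add: tendsto_norm_zero_iff)
  then have "(\<lambda>N. pairing M g f - (pairing M g f - (\<Sum>n<N. coef f n * coef g n))) \<longlonglongrightarrow> pairing M g f - 0"
    by (intro tendsto_intros)
  then show ?thesis by (simp add: sums_def)
qed

end

section \<open>Laguerre functions on the half-line\<close>

abbreviation half_line :: "real measure" where
  "half_line \<equiv> restrict_space lborel {0<..}"

section \<open>Gamma integrals on the half-line\<close>

lemma half_line_measurable: "f \<in> borel_measurable borel \<Longrightarrow> f \<in> borel_measurable half_line"
  by (rule measurable_restrict_space1) simp

lemma integrable_power_times_exp:
  assumes "0 < Re \<beta>"
  shows "integrable half_line (\<lambda>x. complex_of_real x ^ k * exp (- (\<beta> * of_real x)))"
proof (rule Bochner_Integration.integrable_bound)
  \<comment> \<open>On the half-line the modulus of the integrand is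
    \<open>fact k / l ^ Suc k\<close> times the Erlang density of rate \<open>l\<close>, whose total
    mass is its zeroth moment.\<close>
  define l where "l = Re \<beta>"
  have l: "l > 0" using assms by (simp add: l_def)
  have "(\<integral>\<^sup>+ x. ennreal (erlang_density k l x) \<partial>lborel) = 1"
    using nn_integral_erlang_ith_moment[OF l, of k 0] by simp
  then have "integrable lborel (erlang_density k l)"
    by (intro integrableI_nonneg) (auto simp: l less_imp_le)
  then have "integrable lborel (\<lambda>x. indicator {0<..} x *\<^sub>R erlang_density k l x)"
    by (intro integrable_mult_indicator) auto
  then show "integrable half_line (\<lambda>x. fact k / l ^ Suc k * erlang_density k l x)"
    by (subst integrable_restrict_space) (auto simp: mult.left_commute)
  show "(\<lambda>x. complex_of_real x ^ k * exp (- (\<beta> * of_real x))) \<in> borel_measurable half_line"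
    by (intro half_line_measurable borel_measurable_continuous_onI continuous_intros)
  show "AE x in half_line. norm (complex_of_real x ^ k * exp (- (\<beta> * of_real x)))
      \<le> norm (fact k / l ^ Suc k * erlang_density k l x)"
    using l by (auto simp: space_restrict_space erlang_density_def norm_mult norm_power l_def)
qed

lemma power_times_exp_tendsto_0:
  assumes "0 < Re \<beta>"
  shows "((\<lambda>x. complex_of_real x ^ k * exp (- (\<beta> * of_real x))) \<longlongrightarrow> 0) at_top"
proof (rule tendsto_norm_zero_cancel)
  define l where "l = Re \<beta>"
  have l: "l > 0" using assms by (simp add: l_def)
  have f: "filterlim (\<lambda>x. l * x) at_top at_top"
    using l by (intro filterlim_tendsto_pos_mult_at_top[OF tendsto_const]) (auto simp: filterlim_ident)
  have "((\<lambda>x. (l * x) ^ k / exp (l * x) / l ^ k) \<longlongrightarrow> 0 / l ^ k) at_top"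
    using l by (intro tendsto_intros filterlim_compose[OF tendsto_power_div_exp_0 f]) auto
  then have "((\<lambda>x. x ^ k * exp (- (l * x))) \<longlongrightarrow> 0) at_top"
    using l by (simp add: power_mult_distrib exp_minus field_simps)
  moreover have "\<forall>\<^sub>F x in at_top. x ^ k * exp (- (l * x)) = norm (complex_of_real x ^ k * exp (- (\<beta> * of_real x)))"
    using eventually_ge_at_top[of 0] by eventually_elim (simp add: norm_mult norm_power l_def)
  ultimately show "((\<lambda>x. norm (complex_of_real x ^ k * exp (- (\<beta> * of_real x)))) \<longlongrightarrow> 0) at_top"
    by (rule Lim_transform_eventually)
qed

lemma integral_half_line_FTC:
  fixes F f :: "real \<Rightarrow> complex"
  assumes F: "\<And>x. (F has_vector_derivative f x) (at x)"
    and cont: "\<And>x. isCont f x" and int: "integrable half_line f" and lim: "(F \<longlongrightarrow> 0) at_top"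
  shows "(LINT x|half_line. f x) = - F 0"
proof -
  have s: "set_integrable lborel {0<..} f"
    using int unfolding set_integrable_def by (subst (asm) integrable_restrict_space) auto
  have "(LBINT x=0..\<infinity>. f x) = 0 - F 0"
  proof (rule interval_integral_FTC_integrable[where F = F])
    show "set_integrable lborel (einterval 0 \<infinity>) f"
      using s by (simp add: zero_ereal_def)
    have "isCont F 0"
      using F has_vector_derivative_continuous by blast
    then have "(F \<longlongrightarrow> F 0) (at_right 0)"
      by (simp add: continuous_at_imp_continuous_at_within continuous_within[symmetric])
    then show "((F \<circ> real_of_ereal) \<longlongrightarrow> F 0) (at_right 0)"
      by (simp add: zero_ereal_def ereal_tendsto_simps)
    show "((F \<circ> real_of_ereal) \<longlongrightarrow> 0) (at_left \<infinity>)"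
      using lim by (simp add: ereal_tendsto_simps)
  qed (use F cont in auto)
  then have "(LINT x:{0<..}|lborel. f x) = - F 0"
    by (simp add: interval_lebesgue_integral_0_infty)
  then show ?thesis
    unfolding set_lebesgue_integral_def by (subst integral_restrict_space) auto
qed

lemma integral_power_times_exp:
  assumes "0 < Re \<beta>"
  shows "(LINT x|half_line. complex_of_real x ^ k * exp (- (\<beta> * of_real x))) = fact k / \<beta> ^ Suc k"
proof (induction k)
  case 0
  have b: "\<beta> \<noteq> 0" using assms by auto
  have "(LINT x|half_line. exp (- (\<beta> * of_real x))) = - (- (exp (- (\<beta> * of_real 0)) / \<beta>))"
  proof (rule integral_half_line_FTC)
    show "((\<lambda>x. - (exp (- (\<beta> * of_real x)) / \<beta>)) has_vector_derivative exp (- (\<beta> * of_real x))) (at x)" for x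
      by (rule has_vector_derivative_real_field[of "\<lambda>u. - (exp (- (\<beta> * u)) / \<beta>)"])
         (use b in \<open>auto intro!: derivative_eq_intros\<close>)
    show "isCont (\<lambda>x. exp (- (\<beta> * complex_of_real x))) x" for x
      by (intro continuous_intros)
    show "integrable half_line (\<lambda>x. exp (- (\<beta> * complex_of_real x)))"
      using integrable_power_times_exp[OF assms, of 0] by simp
    have "((\<lambda>x. - (exp (- (\<beta> * complex_of_real x)) / \<beta>)) \<longlongrightarrow> - (0 / \<beta>)) at_top"
      using power_times_exp_tendsto_0[OF assms, of 0] b by (intro tendsto_intros) auto
    then show "((\<lambda>x. - (exp (- (\<beta> * complex_of_real x)) / \<beta>)) \<longlongrightarrow> 0) at_top" by simp
  qed
  then show ?case by simp
next
  case (Suc k)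
  have b: "\<beta> \<noteq> 0" using assms by auto
  let ?I = "\<lambda>k x. complex_of_real x ^ k * exp (- (\<beta> * of_real x))"
  note i = integrable_power_times_exp[OF assms]
  \<comment> \<open>Integration by parts: the integrand is the derivative of
    \<open>?I (Suc k)\<close>, which vanishes at 0 and at infinity.\<close>
  have "(LINT x|half_line. of_nat (Suc k) * ?I k x - \<beta> * ?I (Suc k) x) = - ?I (Suc k) 0"
  proof (rule integral_half_line_FTC)
    show "(?I (Suc k) has_vector_derivative of_nat (Suc k) * ?I k x - \<beta> * ?I (Suc k) x) (at x)" for x
    proof (rule has_vector_derivative_real_field[of "\<lambda>u. u ^ Suc k * exp (- (\<beta> * u))"])
      have "((\<lambda>u. exp (- (\<beta> * u))) has_field_derivative - \<beta> * exp (- (\<beta> * of_real x))) (at (of_real x))"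
        by (auto intro!: derivative_eq_intros)
      from DERIV_mult[OF DERIV_power_Suc[OF DERIV_ident] this]
      show "((\<lambda>u. u ^ Suc k * exp (- (\<beta> * u))) has_field_derivative of_nat (Suc k) * ?I k x - \<beta> * ?I (Suc k) x)
          (at (complex_of_real x))"
        by (rule DERIV_cong) (simp add: algebra_simps)
    qed
    show "isCont (\<lambda>x. of_nat (Suc k) * ?I k x - \<beta> * ?I (Suc k) x) x" for x
      by (intro continuous_intros)
    show "integrable half_line (\<lambda>x. of_nat (Suc k) * ?I k x - \<beta> * ?I (Suc k) x)"
      using i[of k] i[of "Suc k"] by (intro Bochner_Integration.integrable_diff integrable_mult_right) auto
    show "(?I (Suc k) \<longlongrightarrow> 0) at_top"
      by (rule power_times_exp_tendsto_0[OF assms])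
  qed
  also have "(LINT x|half_line. of_nat (Suc k) * ?I k x - \<beta> * ?I (Suc k) x)
     = of_nat (Suc k) * (LINT x|half_line. ?I k x) - \<beta> * (LINT x|half_line. ?I (Suc k) x)"
    using i[of k] i[of "Suc k"]
    by (subst Bochner_Integration.integral_diff) (auto simp del: of_nat_Suc power_Suc)
  finally have "\<beta> * (LINT x|half_line. ?I (Suc k) x) = of_nat (Suc k) * (fact k / \<beta> ^ Suc k)"
    unfolding Suc by (simp add: algebra_simps)
  then show ?case
    using b by (simp add: field_simps)
qed

text \<open>The Laguerre functions \<open>lag n\<close> correspond to the monomials \<open>z ^ n\<close> of the Hardy space.\<close>

definition lag_coeff :: "nat \<Rightarrow> nat \<Rightarrow> complex" where
  "lag_coeff n k = of_nat (n choose k) * (-2) ^ k / fact k"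

definition lag :: "nat \<Rightarrow> real \<Rightarrow> complex" where
  "lag n x = of_real (sqrt 2) * (\<Sum>k\<le>n. lag_coeff n k * (of_real x ^ k * exp (- of_real x)))"

lemma sq_integrable_power_times_exp:
  assumes "0 < Re \<beta>"
  shows "sq_integrable half_line (\<lambda>x. complex_of_real x ^ k * exp (- (\<beta> * of_real x)))"
  unfolding sq_integrable_def
proof
  show "(\<lambda>x. complex_of_real x ^ k * exp (- (\<beta> * of_real x))) \<in> borel_measurable half_line"
    by (intro half_line_measurable borel_measurable_continuous_onI continuous_intros)
  have "integrable half_line (\<lambda>x. norm (complex_of_real x ^ (k + k) * exp (- ((\<beta> + \<beta>) * of_real x))))"
    using assms by (intro integrable_norm integrable_power_times_exp) auto
  also have "(\<lambda>x. norm (complex_of_real x ^ (k + k) * exp (- ((\<beta> + \<beta>) * of_real x))))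
     = (\<lambda>x. (cmod (complex_of_real x ^ k * exp (- (\<beta> * complex_of_real x))))\<^sup>2)"
  proof
    fix x :: real
    have "exp (- ((\<beta> + \<beta>) * of_real x)) = exp (- (\<beta> * of_real x)) * exp (- (\<beta> * of_real x))"
      by (simp add: algebra_simps flip: exp_add)
    then show "norm (complex_of_real x ^ (k + k) * exp (- ((\<beta> + \<beta>) * of_real x)))
        = (cmod (complex_of_real x ^ k * exp (- (\<beta> * complex_of_real x))))\<^sup>2"
      by (simp add: norm_mult power_add power2_eq_square)
  qed
  finally show "integrable half_line (\<lambda>x. (cmod (complex_of_real x ^ k * exp (- (\<beta> * complex_of_real x))))\<^sup>2)" .
qed

lemma sq_integrable_lag: "sq_integrable half_line (lag n)"
proof -
  have "sq_integrable half_line (\<lambda>x. of_real (sqrt 2) * (\<Sum>k\<le>n. lag_coeff n k * (of_real x ^ k * exp (- (1 * of_real x)))))"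
    by (intro sq_integrable_sum sq_integrable_cmult sq_integrable_power_times_exp) auto
  then show ?thesis by (simp add: lag_def[abs_def])
qed

lemma pairing_power_times_exp:
  assumes "0 < Re \<alpha>" "0 < Re \<beta>"
  shows "pairing half_line (\<lambda>x. complex_of_real x ^ j * exp (- (\<alpha> * of_real x)))
     (\<lambda>x. complex_of_real x ^ k * exp (- (\<beta> * of_real x))) = fact (j + k) / (\<alpha> + \<beta>) ^ Suc (j + k)"
proof -
  have "pairing half_line (\<lambda>x. complex_of_real x ^ j * exp (- (\<alpha> * of_real x)))
     (\<lambda>x. complex_of_real x ^ k * exp (- (\<beta> * of_real x)))
    = (LINT x|half_line. complex_of_real x ^ (j + k) * exp (- ((\<alpha> + \<beta>) * of_real x)))"
    unfolding pairing_def by (simp add: power_add exp_add exp_minus exp_diff field_simps)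
  then show ?thesis
    using integral_power_times_exp[of "\<alpha> + \<beta>" "j + k"] assms by simp
qed

text \<open>This is the Laplace transform of \<open>lag n\<close>, which is sqrt 2 exp (- x) L_n (2
  x) for the Laguerre polynomial L_n. Each term integrates to a power of 1 / (w + 1), and the
  binomial theorem for (w + 1) - 2 collects them.\<close>

lemma pairing_exp_lag:
  assumes "0 < Re w"
  shows "pairing half_line (\<lambda>x. exp (- (w * of_real x))) (lag n) = of_real (sqrt 2) * (w - 1) ^ n / (w + 1) ^ Suc n"
proof -
  have w: "w + 1 \<noteq> 0" using assms by (auto simp: complex_eq_iff)
  have "pairing half_line (\<lambda>x. exp (- (w * of_real x))) (lag n)
     = pairing half_line (lag n) (\<lambda>x. exp (- (w * of_real x)))"
    by (rule pairing_commute)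
  also have "\<dots> = of_real (sqrt 2) * (\<Sum>k\<le>n. lag_coeff n k *
     pairing half_line (\<lambda>x. complex_of_real x ^ k * exp (- (1 * of_real x))) (\<lambda>x. complex_of_real x ^ 0 * exp (- (w * of_real x))))"
    unfolding lag_def[abs_def] pairing_cmult_left
    using sq_integrable_power_times_exp[of w 0] sq_integrable_power_times_exp[of 1] assms
    by (subst pairing_sum_left) auto
  also have "\<dots> = of_real (sqrt 2) * (\<Sum>k\<le>n. lag_coeff n k * (fact k / (1 + w) ^ Suc k))"
    using assms by (subst pairing_power_times_exp) auto
  also have "(\<Sum>k\<le>n. lag_coeff n k * (fact k / (1 + w) ^ Suc k))
     = (\<Sum>k\<le>n. of_nat (n choose k) * (-2) ^ k * (w + 1) ^ (n - k)) / (w + 1) ^ Suc n"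
    unfolding sum_divide_distrib
  proof (intro sum.cong refl)
    fix k assume "k \<in> {..n}"
    then have "(w + 1) ^ Suc n = (w + 1) ^ Suc k * (w + 1) ^ (n - k)"
      by (simp flip: power_add)
    then show "lag_coeff n k * (fact k / (1 + w) ^ Suc k)
       = of_nat (n choose k) * (-2) ^ k * (w + 1) ^ (n - k) / (w + 1) ^ Suc n"
      using w by (simp add: lag_coeff_def divide_simps add.commute del: power_Suc)
  qed
  also have "(\<Sum>k\<le>n. of_nat (n choose k) * (-2) ^ k * (w + 1) ^ (n - k)) = (w - 1) ^ n"
    using binomial_ring[of "-2" "w + 1" n] by simp
  finally show ?thesis by simp
qed

text \<open>The left side is, up to sign, the m-th finite difference in \<open>r\<close> of
  \<open>r choose k\<close>, and each difference lowers \<open>k\<close> by one. Pascal's rule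
  writes the sum for \<open>Suc m\<close> as the difference of the sums for \<open>m\<close> at
  \<open>r\<close> and at \<open>Suc r\<close>.\<close>

lemma sum_alternating_binomial_shift:
  "(\<Sum>j\<le>m. (-1) ^ j * of_nat (m choose j) * of_nat ((r + j) choose k))
     = (if m \<le> k then (-1) ^ m * of_nat (r choose (k - m)) else (0::complex))"
proof (induction m arbitrary: r)
  case (Suc m)
  let ?f = "\<lambda>m r j. (-1) ^ j * of_nat (m choose j) * (of_nat ((r + j) choose k) :: complex)"
  have "(\<Sum>j\<le>Suc m. ?f (Suc m) r j) = ?f (Suc m) r 0 + (\<Sum>j\<le>m. ?f (Suc m) r (Suc j))"
    by (rule sum.atMost_Suc_shift)
  also have "(\<Sum>j\<le>m. ?f (Suc m) r (Suc j)) = (\<Sum>j\<le>m. ?f m r (Suc j)) - (\<Sum>j\<le>m. ?f m (Suc r) j)"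
    by (subst sum_subtractf[symmetric], intro sum.cong refl) (simp add: algebra_simps)
  also have "?f (Suc m) r 0 + ((\<Sum>j\<le>m. ?f m r (Suc j)) - (\<Sum>j\<le>m. ?f m (Suc r) j))
     = (?f m r 0 + (\<Sum>j\<le>m. ?f m r (Suc j))) - (\<Sum>j\<le>m. ?f m (Suc r) j)"
    by simp
  also have "?f m r 0 + (\<Sum>j\<le>m. ?f m r (Suc j)) = (\<Sum>j\<le>Suc m. ?f m r j)"
    by (rule sum.atMost_Suc_shift[symmetric])
  also have "\<dots> = (\<Sum>j\<le>m. ?f m r j)" by simp
  finally have "(\<Sum>j\<le>Suc m. ?f (Suc m) r j)
     = (if m \<le> k then (-1) ^ m * of_nat (r choose (k - m)) else 0)
       - (if m \<le> k then (-1) ^ m * of_nat (Suc r choose (k - m)) else 0)"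
    unfolding Suc by simp
  also have "\<dots> = (if Suc m \<le> k then (-1) ^ Suc m * of_nat (r choose (k - Suc m)) else 0)"
  proof (cases "Suc m \<le> k")
    case True
    then have "k - m = Suc (k - Suc m)" by simp
    then show ?thesis using True by (simp add: algebra_simps)
  qed auto
  finally show ?case .
qed simp

text \<open>The functions x^k exp (- x) pair to factorials over powers of 2; the powers cancel
  against the factors (-2)^k and binomials remain. The inner sum is a finite difference and yields
  \<open>k choose n\<close> up to sign. The identity \<open>choose_mult\<close> then leaves an
  alternating sum of \<open>d choose i\<close> with m = n + d, which is zero unless d = 0.\<close>

lemma pairing_lag: "pairing half_line (lag m) (lag n) = (if m = n then 1 else 0)"
proof -
  let ?e = "\<lambda>k x. complex_of_real x ^ k * exp (- (1 * of_real x))"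
  have s: "sq_integrable half_line (?e k)" for k
    by (rule sq_integrable_power_times_exp) simp
  have sl: "sq_integrable half_line (\<lambda>x. \<Sum>k\<le>n. lag_coeff n k * ?e k x)" for n
    by (intro sq_integrable_sum sq_integrable_cmult s)
  have lag_e: "lag n = (\<lambda>x. of_real (sqrt 2) * (\<Sum>k\<le>n. lag_coeff n k * ?e k x))" for n
    by (simp add: lag_def[abs_def])
  have e_lag: "pairing half_line (?e k) (\<lambda>x. \<Sum>j\<le>n. lag_coeff n j * ?e j x)
      = (\<Sum>j\<le>n. lag_coeff n j * pairing half_line (?e j) (?e k))" for k
    by (subst pairing_commute) (rule pairing_sum_left[OF s s])
  have "pairing half_line (lag m) (lag n) = of_real (sqrt 2) * (of_real (sqrt 2) *
      (\<Sum>k\<le>m. lag_coeff m k * (\<Sum>j\<le>n. lag_coeff n j * pairing half_line (?e j) (?e k))))"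
    unfolding lag_e pairing_cmult_left pairing_cmult_right pairing_sum_left[OF s sl] e_lag by (rule refl)
  also have "\<dots> = of_real (sqrt 2) * of_real (sqrt 2) *
      (\<Sum>k\<le>m. lag_coeff m k * (\<Sum>j\<le>n. lag_coeff n j * pairing half_line (?e j) (?e k)))"
    by (rule mult.assoc[symmetric])
  also have "complex_of_real (sqrt 2) * of_real (sqrt 2) = 2"
    by (simp flip: of_real_mult)
  also have "2 * (\<Sum>k\<le>m. lag_coeff m k * (\<Sum>j\<le>n. lag_coeff n j * pairing half_line (?e j) (?e k)))
     = (\<Sum>k\<le>m. (-1) ^ k * of_nat (m choose k) * (\<Sum>j\<le>n. (-1) ^ j * of_nat (n choose j) * of_nat ((k + j) choose k)))"
    unfolding sum_distrib_left
  proof (intro sum.cong refl)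
    fix k j
    have "(fact (j + k) :: complex) = fact k * fact j * of_nat ((k + j) choose k)"
    proof -
      have "fact k * fact j * ((k + j) choose k) = (fact (j + k) :: nat)"
        using binomial_fact_lemma[of k "k + j"] by (simp add: add.commute)
      then have "of_nat (fact k * fact j * ((k + j) choose k)) = (of_nat (fact (j + k)) :: complex)"
        by (rule arg_cong)
      then show ?thesis by simp
    qed
    moreover have "pairing half_line (?e j) (?e k) = fact (j + k) / 2 ^ Suc (j + k)"
      by (subst pairing_power_times_exp) auto
    moreover have "(-2 :: complex) ^ i = (-1) ^ i * 2 ^ i" for i
      by (subst power_mult_distrib[symmetric]) simp
    ultimately show "2 * (lag_coeff m k * (lag_coeff n j * pairing half_line (?e j) (?e k))) =
       (- 1) ^ k * of_nat (m choose k) * ((- 1) ^ j * of_nat (n choose j) * of_nat (k + j choose k))"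
      by (simp add: lag_coeff_def power_add)
  qed
  also have "\<dots> = (\<Sum>k\<le>m. if n \<le> k then (-1) ^ n * ((-1) ^ k * of_nat ((m choose k) * (k choose n))) else 0)"
    unfolding sum_alternating_binomial_shift
    by (intro sum.cong refl) (auto simp: binomial_symmetric[symmetric] simp flip: binomial_symmetric)
  also have "\<dots> = (if m = n then 1 else 0)"
  proof (cases "n \<le> m")
    case True
    then obtain d where d: "m = n + d" by (metis le_Suc_ex)
    have "(\<Sum>k\<le>m. if n \<le> k then (-1) ^ n * ((-1) ^ k * of_nat ((m choose k) * (k choose n))) else (0::complex))
       = (\<Sum>k\<in>{n..m}. (-1) ^ n * ((-1) ^ k * of_nat ((m choose k) * (k choose n))))"
      by (intro sum.mono_neutral_cong_right) auto
    also have "\<dots> = (\<Sum>i\<le>d. (-1) ^ n * ((-1) ^ (n + i) * of_nat ((m choose (n + i)) * ((n + i) choose n))))"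
      by (rule sum.reindex_bij_witness[of _ "\<lambda>i. n + i" "\<lambda>k. k - n"]) (auto simp: d)
    also have "\<dots> = (\<Sum>i\<le>d. of_nat (m choose n) * ((-1) ^ i * of_nat (d choose i)))"
    proof (intro sum.cong refl)
      fix i assume "i \<in> {..d}"
      then have "(m choose (n + i)) * ((n + i) choose n) = (m choose n) * (d choose i)"
        using choose_mult[of n "n + i" m] by (simp add: d)
      moreover have "(-1) ^ n * (-1) ^ (n + i) = ((-1) ^ i :: complex)"
        by (simp add: power_add flip: mult.assoc power_mult_distrib)
      ultimately show "(-1) ^ n * ((-1) ^ (n + i) * of_nat ((m choose (n + i)) * ((n + i) choose n)))
          = of_nat (m choose n) * ((-1) ^ i * of_nat (d choose i) :: complex)"
        by simp
    qed
    also have "\<dots> = of_nat (m choose n) * (if d = 0 then 1 else 0)"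
      using choose_alternating_sum[of d, where 'a = complex] by (simp flip: sum_distrib_left)
    finally show ?thesis by (auto simp: d)
  qed (auto intro!: sum.neutral)
  finally show ?thesis .
qed

interpretation lag: real_orthonormal half_line lag
proof
  show "cnj (lag n x) = lag n x" for n x
    by (simp add: lag_def lag_coeff_def exp_cnj)
qed (rule sq_integrable_lag pairing_lag)+

section \<open>The Cayley transform and the evaluation kernels\<close>

definition cayley :: "complex \<Rightarrow> complex" where
  "cayley z = (1 + z) / (1 - z)"

lemma Re_cayley:
  assumes "z \<noteq> 1"
  shows "Re (cayley z) = (1 - (cmod z)\<^sup>2) / (cmod (1 - z))\<^sup>2"
proof -
  have z: "1 - z \<noteq> 0" using assms by auto
  have "cayley z = (1 + z) * cnj (1 - z) / of_real ((cmod (1 - z))\<^sup>2)"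
    unfolding cayley_def using z by (simp add: complex_norm_square del: of_real_power)
  then have "Re (cayley z) = Re ((1 + z) * cnj (1 - z)) / (cmod (1 - z))\<^sup>2"
    by (simp only: Re_divide_of_real)
  also have "Re ((1 + z) * cnj (1 - z)) = 1 - (cmod z)\<^sup>2"
    unfolding cmod_power2 by (simp add: algebra_simps power2_eq_square)
  finally show ?thesis .
qed

lemma Re_cayley_pos: 
  assumes "cmod z < 1"
  shows "0 < Re (cayley z)"
proof -
  have "z \<noteq> 1" using assms by auto
  moreover have "(cmod z)\<^sup>2 < 1" using assms by (simp add: power_less_one_iff)
  ultimately show ?thesis by (simp add: Re_cayley)
qed

text \<open>In terms of functions \<open>g\<close> on the half-line, evaluation at \<open>z\<close> is the pairing of \<open>g\<close> with
  \<open>eval_ker z\<close>.\<close>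

definition eval_ker :: "complex \<Rightarrow> real \<Rightarrow> complex" where
  "eval_ker z x = of_real (sqrt 2) / (1 - z) * exp (- (cayley z * of_real x))"

lemma sq_integrable_eval_ker: "cmod z < 1 \<Longrightarrow> sq_integrable half_line (eval_ker z)"
  using sq_integrable_power_times_exp[OF Re_cayley_pos, of z 0]
  unfolding eval_ker_def[abs_def] by (intro sq_integrable_cmult) simp

text \<open>With w = \<open>cayley z\<close>, (w - 1) / (w + 1) is z and w + 1 is 2 / (1 - z), so
  the Laplace transform of \<open>lag n\<close> at w is a multiple of z^n. The factor sqrt 2 / (1 -
  z) in \<open>eval_ker\<close> is chosen to make that multiple 1.\<close>

lemma coef_eval_ker:
  assumes "cmod z < 1"
  shows "lag.coef (eval_ker z) n = z ^ n"
proof -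
  have z: "1 - z \<noteq> 0" using assms by auto
  have w: "cayley z - 1 = z * (2 / (1 - z))" "cayley z + 1 = 2 / (1 - z)"
    using z by (auto simp: cayley_def field_simps)
  have s: "complex_of_real (sqrt 2) * of_real (sqrt 2) = 2"
    by (simp flip: of_real_mult)
  have "lag.coef (eval_ker z) n = of_real (sqrt 2) / (1 - z) * (of_real (sqrt 2) * (cayley z - 1) ^ n / (cayley z + 1) ^ Suc n)"
    unfolding lag.coef_def eval_ker_def[abs_def] pairing_cmult_left
    by (simp only: pairing_exp_lag[OF Re_cayley_pos[OF assms]])
  also have "\<dots> = (complex_of_real (sqrt 2) * of_real (sqrt 2)) / (1 - z) * ((cayley z - 1) ^ n / (cayley z + 1) ^ Suc n)"
    by simp
  also have "\<dots> = z ^ n"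
    unfolding w s power_mult_distrib using z by (simp add: field_simps)
  finally show ?thesis .
qed

text \<open>The value is the sum of all |z|^(2n), hence of the squared moduli of the coefficients:
  this is Parseval's identity for the kernels, obtained by computing the norm as an exponential
  integral.\<close>

lemma sq_norm_eval_ker:
  assumes "cmod z < 1"
  shows "sq_norm half_line (eval_ker z) = 1 / (1 - (cmod z)\<^sup>2)"
proof -
  let ?w = "cayley z"
  have z: "1 - z \<noteq> 0" using assms by auto
  have w: "0 < Re ?w" using Re_cayley_pos[OF assms] .
  have "sq_norm half_line (eval_ker z) = (LINT x|half_line. 2 / (cmod (1 - z))\<^sup>2 * exp (- (2 * Re ?w * x)))"
    unfolding sq_norm_def eval_ker_def
    by (simp add: norm_mult norm_divide power_mult_distrib power_divide mult.assoc exp_double[symmetric] flip: exp_of_nat_mult)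
  then have "complex_of_real (sq_norm half_line (eval_ker z))
     = 2 / of_real ((cmod (1 - z))\<^sup>2) * (LINT x|half_line. complex_of_real (exp (- (2 * Re ?w * x))))"
    by simp
  also have "(LINT x|half_line. complex_of_real (exp (- (2 * Re ?w * x)))) = 1 / of_real (2 * Re ?w)"
    using integral_power_times_exp[of "of_real (2 * Re ?w)" 0] w by (simp add: exp_of_real[symmetric])
  also have "2 / of_real ((cmod (1 - z))\<^sup>2) * (1 / of_real (2 * Re ?w)) = complex_of_real (2 / (cmod (1 - z))\<^sup>2 * (1 / (2 * Re ?w)))"
    by simp
  finally have eq: "sq_norm half_line (eval_ker z) = 2 / (cmod (1 - z))\<^sup>2 * (1 / (2 * Re ?w))"
    unfolding of_real_eq_iff .
  have "2 / d * (1 / (2 * (n / d))) = 1 / n" if "d \<noteq> 0" for d n :: real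
    using that by simp
  moreover have "z \<noteq> 1" "(cmod (1 - z))\<^sup>2 \<noteq> 0" using z by auto
  ultimately show ?thesis
    unfolding eq Re_cayley[OF \<open>z \<noteq> 1\<close>] by blast
qed

lemma pairing_eval_ker_sums:
  assumes "cmod z < 1" "sq_integrable half_line g"
  shows "(\<lambda>n. z ^ n * lag.coef g n) sums pairing half_line g (eval_ker z)"
proof -
  have "(cmod z)\<^sup>2 < 1" using assms by (simp add: power_less_one_iff)
  then have "(\<lambda>n. ((cmod z)\<^sup>2) ^ n) sums (1 / (1 - (cmod z)\<^sup>2))"
    by (intro geometric_sums) simp
  then have "(\<lambda>n. (cmod (lag.coef (eval_ker z) n))\<^sup>2) sums sq_norm half_line (eval_ker z)"
    by (simp add: coef_eval_ker sq_norm_eval_ker assms norm_power mult.commute flip: power_mult)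
  from lag.pairing_sums_of_Parseval[OF sq_integrable_eval_ker this assms(2)] show ?thesis
    using assms by (simp add: coef_eval_ker)
qed

section \<open>Square-summable sequences and symmetric matrices\<close>

definition l2 :: "(nat \<Rightarrow> complex) set" where
  "l2 = {a. summable (\<lambda>n. (cmod (a n))\<^sup>2)}"

definition l2_sq :: "(nat \<Rightarrow> complex) \<Rightarrow> real" where
  "l2_sq a = (\<Sum>n. (cmod (a n))\<^sup>2)"

definition dot :: "(nat \<Rightarrow> complex) \<Rightarrow> (nat \<Rightarrow> complex) \<Rightarrow> complex" where
  "dot a b = (\<Sum>n. a n * b n)"

definition unit_seq :: "nat \<Rightarrow> nat \<Rightarrow> complex" where
  "unit_seq n k = (if k = n then 1 else 0)"

lemma l2_sq_nonneg: "a \<in> l2 \<Longrightarrow> 0 \<le> l2_sq a"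
  unfolding l2_sq_def l2_def by (intro suminf_nonneg) auto

lemma l2_sums: "a \<in> l2 \<Longrightarrow> (\<lambda>n. (cmod (a n))\<^sup>2) sums l2_sq a"
  by (simp add: l2_def l2_sq_def summable_sums)

lemma summable_mult_l2:
  assumes "a \<in> l2" "b \<in> l2"
  shows "summable (\<lambda>n. cmod (a n * b n))"
proof (rule summable_comparison_test')
  show "summable (\<lambda>n. (cmod (a n))\<^sup>2 + (cmod (b n))\<^sup>2)"
    using assms by (intro summable_add) (auto simp: l2_def)
  have "x * y \<le> x\<^sup>2 + y\<^sup>2" for x y :: real
    using sum_squares_bound[of x y] zero_le_power2[of x] zero_le_power2[of y] by linarith
  then show "norm (cmod (a n * b n)) \<le> (cmod (a n))\<^sup>2 + (cmod (b n))\<^sup>2" if "n \<ge> 0" for n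
    by (simp add: norm_mult)
qed

lemma dot_sums: "a \<in> l2 \<Longrightarrow> b \<in> l2 \<Longrightarrow> (\<lambda>n. a n * b n) sums dot a b"
  unfolding dot_def by (intro summable_sums summable_norm_cancel[OF summable_mult_l2])

lemma dot_commute: "dot a b = dot b a"
  by (simp add: dot_def mult.commute)

lemma l2_add:
  assumes "a \<in> l2" "b \<in> l2"
  shows "(\<lambda>n. a n + b n) \<in> l2" "l2_sq (\<lambda>n. a n + b n) \<le> 2 * l2_sq a + 2 * l2_sq b"
proof -
  have s: "(\<lambda>n. 2 * (cmod (a n))\<^sup>2 + 2 * (cmod (b n))\<^sup>2) sums (2 * l2_sq a + 2 * l2_sq b)"
    using assms by (intro sums_add sums_mult l2_sums)
  show l: "(\<lambda>n. a n + b n) \<in> l2"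
    unfolding l2_def mem_Collect_eq
    by (rule summable_comparison_test'[OF sums_summable[OF s]]) (use cmod_add_sq_le in auto)
  show "l2_sq (\<lambda>n. a n + b n) \<le> 2 * l2_sq a + 2 * l2_sq b"
    by (rule sums_le[OF cmod_add_sq_le l2_sums[OF l] s])
qed

lemma l2_cmult:
  assumes "a \<in> l2"
  shows "(\<lambda>n. k * a n) \<in> l2" "l2_sq (\<lambda>n. k * a n) = (cmod k)\<^sup>2 * l2_sq a"
proof -
  have s: "(\<lambda>n. (cmod (k * a n))\<^sup>2) sums ((cmod k)\<^sup>2 * l2_sq a)"
    using sums_mult[OF l2_sums[OF assms]] by (simp add: norm_mult power_mult_distrib)
  show "(\<lambda>n. k * a n) \<in> l2" "l2_sq (\<lambda>n. k * a n) = (cmod k)\<^sup>2 * l2_sq a"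
    using s by (auto simp: l2_def l2_sq_def sums_iff)
qed

lemma l2_diff: "a \<in> l2 \<Longrightarrow> b \<in> l2 \<Longrightarrow> (\<lambda>n. a n - b n) \<in> l2"
  using l2_add(1)[of a "\<lambda>n. -1 * b n"] l2_cmult(1)[of b "-1"] by simp

lemma l2_unit_seq: "unit_seq n \<in> l2"
  unfolding l2_def mem_Collect_eq by (rule summable_finite[of "{n}"]) (auto simp: unit_seq_def)

lemma l2_power:
  assumes "cmod z < 1"
  shows "(\<lambda>n. z ^ n) \<in> l2"
proof -
  have "(cmod z)\<^sup>2 < 1" using assms by (simp add: power_less_one_iff)
  then have "summable (\<lambda>n. ((cmod z)\<^sup>2) ^ n)" by (intro summable_geometric) simp
  then show ?thesis by (simp add: l2_def norm_power mult.commute flip: power_mult)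
qed

lemma dot_unit_seq: "dot a (unit_seq n) = a n"
proof -
  have "(\<Sum>k. a k * unit_seq n k) = (\<Sum>k\<in>{n}. a k * unit_seq n k)"
    by (rule suminf_finite) (auto simp: unit_seq_def)
  then show ?thesis by (simp add: dot_def unit_seq_def)
qed

lemma dot_diff_right:
  assumes "a \<in> l2" "b \<in> l2" "c \<in> l2"
  shows "dot a (\<lambda>n. b n - c n) = dot a b - dot a c"
  using sums_diff[OF dot_sums[OF assms(1,2)] dot_sums[OF assms(1,3)]]
  by (simp add: dot_def sums_iff algebra_simps)

lemma dot_cmult_right:
  assumes "a \<in> l2" "b \<in> l2"
  shows "dot a (\<lambda>n. k * b n) = k * dot a b"
  using sums_mult[OF dot_sums[OF assms], of k] by (simp add: dot_def sums_iff algebra_simps)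

lemma dot_Cauchy_Schwarz:
  assumes a: "a \<in> l2" and b: "b \<in> l2"
  shows "(cmod (dot a b))\<^sup>2 \<le> l2_sq a * l2_sq b"
proof (rule LIMSEQ_le_const2)
  show "(\<lambda>N. (cmod (\<Sum>n<N. a n * b n))\<^sup>2) \<longlonglongrightarrow> (cmod (dot a b))\<^sup>2"
    using dot_sums[OF a b] unfolding sums_def by (intro tendsto_intros)
  have "(cmod (\<Sum>n<N. a n * b n))\<^sup>2 \<le> l2_sq a * l2_sq b" for N
  proof -
    have le: "(\<Sum>n<N. (cmod (c n))\<^sup>2) \<le> l2_sq c" if "c \<in> l2" for c
      using that unfolding l2_sq_def l2_def by (intro sum_le_suminf) auto
    have "cmod (\<Sum>n<N. a n * b n) \<le> (\<Sum>n<N. cmod (a n) * cmod (b n))"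
      by (rule order_trans[OF norm_sum]) (simp add: norm_mult)
    then have "(cmod (\<Sum>n<N. a n * b n))\<^sup>2 \<le> (\<Sum>n<N. cmod (a n) * cmod (b n))\<^sup>2"
      by (intro power_mono) auto
    also have "\<dots> \<le> (\<Sum>n<N. (cmod (a n))\<^sup>2) * (\<Sum>n<N. (cmod (b n))\<^sup>2)"
      by (rule Cauchy_Schwarz_ineq_sum)
    also have "\<dots> \<le> l2_sq a * l2_sq b"
      using le[OF a] le[OF b] by (intro mult_mono) (auto simp: l2_sq_nonneg assms intro: sum_nonneg)
    finally show ?thesis .
  qed
  then show "\<exists>N0. \<forall>N\<ge>N0. (cmod (\<Sum>n<N. a n * b n))\<^sup>2 \<le> l2_sq a * l2_sq b" by blast
qed

section \<open>Bounded symmetric matrices on l2\<close>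

definition mat_app :: "(nat \<Rightarrow> nat \<Rightarrow> complex) \<Rightarrow> (nat \<Rightarrow> complex) \<Rightarrow> nat \<Rightarrow> complex" where
  "mat_app m a j = (\<Sum>k. m j k * a k)"

text \<open>\<open>bound\<close> speaks of finite sections, which is the form Bessel's inequality
  delivers; letting N and then J tend to infinity gives a bounded operator on l2.\<close>

locale bounded_symmetric_matrix =
  fixes m :: "nat \<Rightarrow> nat \<Rightarrow> complex" and B :: real
  assumes symmetric: "m j k = m k j"
    and bound: "(\<Sum>j<J. (cmod (\<Sum>k<N. m j k * a k))\<^sup>2) \<le> B * (\<Sum>k<N. (cmod (a k))\<^sup>2)"
begin

lemma row_l2: "m j \<in> l2"
proof -
  \<comment> \<open>Applied to a unit sequence, \<open>bound\<close> controls a column, and symmetry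
    turns the column into a row.\<close>
  have *: "(\<Sum>k<Suc j. m i k * unit_seq j k) = m i j" for i
    by (simp add: unit_seq_def)
  have **: "(\<Sum>k<Suc j. (cmod (unit_seq j k))\<^sup>2) = 1"
    by (simp add: unit_seq_def)
  have "(\<Sum>i<J. (cmod (m j i))\<^sup>2) \<le> B" for J
    using bound[where J = J and N = "Suc j" and a = "unit_seq j"] unfolding * ** 
    by (simp add: symmetric[of j])
  then show ?thesis
    unfolding l2_def mem_Collect_eq by (intro summableI_nonneg_bounded) auto
qed

lemma mat_app_dot: "mat_app m a j = dot (m j) a"
  by (simp add: mat_app_def dot_def)

lemma mat_app_sums: "a \<in> l2 \<Longrightarrow> (\<lambda>k. m j k * a k) sums mat_app m a j"
  unfolding mat_app_dot by (rule dot_sums[OF row_l2])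

lemma
  assumes a: "a \<in> l2"
  shows mat_app_l2: "mat_app m a \<in> l2" and mat_app_bound: "l2_sq (mat_app m a) \<le> B * l2_sq a"
proof -
  have le: "(\<Sum>j<J. (cmod (mat_app m a j))\<^sup>2) \<le> B * l2_sq a" for J
  proof (rule LIMSEQ_le)
    show "(\<lambda>N. \<Sum>j<J. (cmod (\<Sum>k<N. m j k * a k))\<^sup>2) \<longlonglongrightarrow> (\<Sum>j<J. (cmod (mat_app m a j))\<^sup>2)"
      using mat_app_sums[OF a] unfolding sums_def by (intro tendsto_intros)
    show "(\<lambda>N. B * (\<Sum>k<N. (cmod (a k))\<^sup>2)) \<longlonglongrightarrow> B * l2_sq a"
      using l2_sums[OF a] unfolding sums_def by (intro tendsto_intros)
  qed (use bound in blast)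
  have s: "summable (\<lambda>j. (cmod (mat_app m a j))\<^sup>2)"
    by (rule summableI_nonneg_bounded[OF _ le]) auto
  then show "mat_app m a \<in> l2" by (simp add: l2_def)
  show "l2_sq (mat_app m a) \<le> B * l2_sq a"
    unfolding l2_sq_def[of "mat_app m a"] by (rule suminf_le_const[OF s le])
qed

lemma mat_app_add: "a \<in> l2 \<Longrightarrow> b \<in> l2 \<Longrightarrow> mat_app m (\<lambda>n. a n + b n) = (\<lambda>j. mat_app m a j + mat_app m b j)"
  using sums_add[OF mat_app_sums mat_app_sums, of a b]
  by (intro ext) (simp add: mat_app_def sums_iff algebra_simps)

lemma mat_app_cmult: "a \<in> l2 \<Longrightarrow> mat_app m (\<lambda>n. k * a n) = (\<lambda>j. k * mat_app m a j)"
  unfolding mat_app_dot by (simp add: dot_cmult_right row_l2)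

lemma mat_app_diff: "a \<in> l2 \<Longrightarrow> b \<in> l2 \<Longrightarrow> mat_app m (\<lambda>n. a n - b n) = (\<lambda>j. mat_app m a j - mat_app m b j)"
  unfolding mat_app_dot by (simp add: dot_diff_right row_l2)

text \<open>Boundedness of the matrix does not make the double series absolutely convergent, so the
  two summations cannot simply be exchanged. Truncating b leaves a finite outer sum, where the
  exchange is harmless; the operator bound and Cauchy-Schwarz make the tail of b vanish in the
  limit.\<close>

lemma dot_mat_app:
  assumes a: "a \<in> l2" and b: "b \<in> l2"
  shows "dot (mat_app m a) b = dot a (mat_app m b)"
proof -
  define t where "t N n = (if n < N then b n else 0)" for N n
  have t: "t N \<in> l2" for N
    unfolding l2_def mem_Collect_eq by (rule summable_finite[of "{..<N}"]) (auto simp: t_def)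
  have rest: "l2_sq (\<lambda>n. b n - t N n) = l2_sq b - (\<Sum>n<N. (cmod (b n))\<^sup>2)" for N
  proof -
    have "(\<lambda>n. (cmod (t N n))\<^sup>2) sums (\<Sum>n<N. (cmod (t N n))\<^sup>2)"
      by (rule sums_finite) (auto simp: t_def)
    from sums_diff[OF l2_sums[OF b] this]
    have "(\<lambda>n. (cmod (b n))\<^sup>2 - (cmod (t N n))\<^sup>2) sums (l2_sq b - (\<Sum>n<N. (cmod (b n))\<^sup>2))"
      by (simp add: t_def)
    moreover have "(\<lambda>n. (cmod (b n))\<^sup>2 - (cmod (t N n))\<^sup>2) = (\<lambda>n. (cmod (b n - t N n))\<^sup>2)"
      by (auto simp: t_def)
    ultimately show ?thesis by (simp add: l2_sq_def sums_iff)
  qed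
  have step: "(\<Sum>j<N. mat_app m a j * b j) = dot a (mat_app m (t N))" for N
  proof -
    have "(\<lambda>k. \<Sum>j<N. b j * (m j k * a k)) sums (\<Sum>j<N. b j * mat_app m a j)"
      by (intro sums_sum sums_mult mat_app_sums a)
    moreover have "(\<Sum>j<N. b j * (m j k * a k)) = a k * mat_app m (t N) k" for k
    proof -
      have "mat_app m (t N) k = (\<Sum>j<N. m k j * t N j)"
        unfolding mat_app_def by (rule suminf_finite) (auto simp: t_def)
      also have "\<dots> = (\<Sum>j<N. m j k * b j)"
        by (intro sum.cong) (auto simp: t_def symmetric[of k])
      finally show ?thesis by (simp add: sum_distrib_left algebra_simps)
    qed
    ultimately show ?thesis
      by (simp add: dot_def sums_iff mult.commute)
  qed
  have "(\<lambda>N. l2_sq a * (B * (l2_sq b - (\<Sum>n<N. (cmod (b n))\<^sup>2)))) \<longlonglongrightarrow> l2_sq a * (B * (l2_sq b - l2_sq b))"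
    using l2_sums[OF b] unfolding sums_def by (intro tendsto_intros)
  then have 0: "(\<lambda>N. l2_sq a * (B * (l2_sq b - (\<Sum>n<N. (cmod (b n))\<^sup>2)))) \<longlonglongrightarrow> 0" by simp
  have "(\<lambda>N. (cmod (dot a (mat_app m b) - (\<Sum>j<N. mat_app m a j * b j)))\<^sup>2) \<longlonglongrightarrow> 0"
  proof (rule tendsto_sandwich[OF _ _ tendsto_const 0])
    have "(cmod (dot a (mat_app m b) - (\<Sum>j<N. mat_app m a j * b j)))\<^sup>2
        \<le> l2_sq a * (B * (l2_sq b - (\<Sum>n<N. (cmod (b n))\<^sup>2)))" for N
    proof -
      have "dot a (mat_app m b) - (\<Sum>j<N. mat_app m a j * b j) = dot a (mat_app m (\<lambda>n. b n - t N n))"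
        unfolding step by (simp add: mat_app_diff b t dot_diff_right[OF a] mat_app_l2)
      then have "(cmod (dot a (mat_app m b) - (\<Sum>j<N. mat_app m a j * b j)))\<^sup>2
         \<le> l2_sq a * l2_sq (mat_app m (\<lambda>n. b n - t N n))"
        using dot_Cauchy_Schwarz[OF a mat_app_l2[OF l2_diff[OF b t]]] by simp
      also have "\<dots> \<le> l2_sq a * (B * l2_sq (\<lambda>n. b n - t N n))"
        by (intro mult_left_mono mat_app_bound l2_diff b t l2_sq_nonneg a)
      finally show ?thesis unfolding rest .
    qed
    then show "\<forall>\<^sub>F N in sequentially. (cmod (dot a (mat_app m b) - (\<Sum>j<N. mat_app m a j * b j)))\<^sup>2
        \<le> l2_sq a * (B * (l2_sq b - (\<Sum>n<N. (cmod (b n))\<^sup>2)))" by auto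
  qed auto
  then have "(\<lambda>N. sqrt ((cmod (dot a (mat_app m b) - (\<Sum>j<N. mat_app m a j * b j)))\<^sup>2)) \<longlonglongrightarrow> sqrt 0"
    by (rule tendsto_real_sqrt)
  then have "(\<lambda>N. dot a (mat_app m b) - (\<Sum>j<N. mat_app m a j * b j)) \<longlonglongrightarrow> 0"
    by (simp add: tendsto_norm_zero_iff)
  moreover have "(\<lambda>N. dot a (mat_app m b) - (\<Sum>j<N. mat_app m a j * b j)) \<longlonglongrightarrow> dot a (mat_app m b) - dot (mat_app m a) b"
    using dot_sums[OF mat_app_l2[OF a] b] unfolding sums_def by (intro tendsto_intros)
  ultimately show ?thesis
    using LIMSEQ_unique by fastforce
qed

end

text \<open>An entry is a \<open>dot\<close> with a unit sequence. Moving both matrices across by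
  symmetry reverses their order, so an identity on unit sequences gives the opposite composition on
  all of l2.\<close>

lemma mat_app_left_inverse:
  assumes "bounded_symmetric_matrix m B" "bounded_symmetric_matrix m' B'"
    and inv: "\<And>n. mat_app m (mat_app m' (unit_seq n)) = unit_seq n" and a: "a \<in> l2"
  shows "mat_app m' (mat_app m a) = a"
proof
  interpret m: bounded_symmetric_matrix m B by fact
  interpret m': bounded_symmetric_matrix m' B' by fact
  fix n
  have "mat_app m' (mat_app m a) n = dot (mat_app m' (mat_app m a)) (unit_seq n)"
    by (simp add: dot_unit_seq)
  also have "\<dots> = dot a (mat_app m (mat_app m' (unit_seq n)))"
    by (simp add: m.dot_mat_app m'.dot_mat_app m.mat_app_l2 m'.mat_app_l2 l2_unit_seq a)
  finally show "mat_app m' (mat_app m a) n = a n"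
    by (simp add: inv dot_unit_seq)
qed

section \<open>Power series with square-summable coefficients as the Hardy space\<close>

definition power_series :: "(nat \<Rightarrow> complex) \<Rightarrow> complex \<Rightarrow> complex" where
  "power_series a z = (if z \<in> unit_disc then dot a (\<lambda>n. z ^ n) else 0)"

lemma power_series_sums:
  assumes "a \<in> l2" "z \<in> unit_disc"
  shows "(\<lambda>n. a n * z ^ n) sums power_series a z"
  using dot_sums[OF assms(1) l2_power[of z]] assms(2) by (simp add: power_series_def)

lemma power_series_holomorphic_on: "a \<in> l2 \<Longrightarrow> power_series a holomorphic_on unit_disc"
  by (rule power_series_holomorphic[of _ _ a]) (use power_series_sums in auto)

lemma taylor_coeff_power_series:
  assumes "a \<in> l2"
  shows "taylor_coeff (power_series a) = a"
proof
  fix n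
  \<comment> \<open>Convergence at the single point 1/2 already gives the positive radius that a
    formal expansion at 0 asks for.\<close>
  have "summable (\<lambda>n. fps_nth (Abs_fps a) n * (1/2) ^ n)"
    using sums_summable[OF power_series_sums[OF assms, of "1/2"]] by simp
  then have "ereal (norm (1/2 :: complex)) \<le> fps_conv_radius (Abs_fps a)"
    unfolding fps_conv_radius_def by (intro conv_radius_geI) auto
  then have "0 < fps_conv_radius (Abs_fps a)"
    by (rule less_le_trans[rotated]) simp
  moreover have "\<forall>\<^sub>F z in nhds 0. eval_fps (Abs_fps a) z = power_series a z"
  proof -
    have "\<forall>\<^sub>F z in nhds 0. z \<in> unit_disc"
      by (rule eventually_nhds_in_open) auto
    then show ?thesis
      by eventually_elim (use power_series_sums[OF assms] in \<open>simp add: eval_fps_def sums_iff\<close>)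
  qed
  ultimately have "power_series a has_fps_expansion Abs_fps a"
    by (simp add: has_fps_expansion_def)
  from fps_nth_fps_expansion[OF this, of n] show "taylor_coeff (power_series a) n = a n"
    by (simp add: taylor_coeff_def)
qed

lemma power_series_H2: "a \<in> l2 \<Longrightarrow> power_series a \<in> H2"
  using power_series_holomorphic_on by (simp add: H2_def taylor_coeff_power_series) (auto simp: l2_def power_series_def)

lemma H2_norm_power_series: "a \<in> l2 \<Longrightarrow> H2_norm (power_series a) = sqrt (l2_sq a)"
  by (simp add: H2_norm_def taylor_coeff_power_series l2_sq_def)

text \<open>Equality holds as total functions: inside the disc it is the Taylor expansion, outside
  both sides are 0 by convention. Together with \<open>power_series_H2\<close> this identifies H2
  with l2.\<close>

lemma H2_taylor_coeff:
  assumes "f \<in> H2"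
  shows "taylor_coeff f \<in> l2" "f = power_series (taylor_coeff f)"
proof -
  show l: "taylor_coeff f \<in> l2" using assms by (simp add: H2_def l2_def)
  have "f z = power_series (taylor_coeff f) z" for z
  proof (cases "z \<in> unit_disc")
    case True
    have "(\<lambda>n. taylor_coeff f n * z ^ n) sums f z"
      using holomorphic_power_series[of f 0 1 z] assms True by (simp add: H2_def taylor_coeff_def)
    then show ?thesis
      using power_series_sums[OF l True] sums_unique2 by blast
  qed (use assms in \<open>auto simp: H2_def power_series_def\<close>)
  then show "f = power_series (taylor_coeff f)" by blast
qed

lemma H2E:
  assumes "f \<in> H2"
  obtains a where "a \<in> l2" "f = power_series a"
  using H2_taylor_coeff[OF assms] by (rule that)

lemma power_series_inject: "a \<in> l2 \<Longrightarrow> b \<in> l2 \<Longrightarrow> power_series a = power_series b \<Longrightarrow> a = b"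
  by (metis taylor_coeff_power_series)

lemma power_series_add:
  assumes "a \<in> l2" "b \<in> l2"
  shows "power_series (\<lambda>n. a n + b n) = (\<lambda>z. power_series a z + power_series b z)"
proof
  fix z
  show "power_series (\<lambda>n. a n + b n) z = power_series a z + power_series b z"
  proof (cases "z \<in> unit_disc")
    case True
    have "(\<lambda>n. (a n + b n) * z ^ n) sums (power_series a z + power_series b z)"
      using sums_add[OF power_series_sums[OF assms(1) True] power_series_sums[OF assms(2) True]]
      by (simp add: distrib_right)
    then show ?thesis
      by (rule sums_unique2[OF power_series_sums[OF l2_add(1)[OF assms] True]])
  qed (simp add: power_series_def)
qed

lemma power_series_cmult:
  assumes "a \<in> l2"
  shows "power_series (\<lambda>n. k * a n) = (\<lambda>z. k * power_series a z)"
proof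
  fix z show "power_series (\<lambda>n. k * a n) z = k * power_series a z"
    using dot_cmult_right[OF l2_power assms, of z k]
    by (simp add: power_series_def dot_commute[of _ "\<lambda>n. z ^ n"])
qed

section \<open>Multiplication operators\<close>

lemma coef_l2: "sq_integrable half_line g \<Longrightarrow> lag.coef g \<in> l2"
  using lag.summable_coef(1) by (simp add: l2_def)

lemma l2_sq_coef: "sq_integrable half_line g \<Longrightarrow> l2_sq (lag.coef g) \<le> sq_norm half_line g"
  using lag.summable_coef(2) by (simp add: l2_sq_def)

lemma coef_lag: "lag.coef (lag n) = unit_seq n"
  by (simp add: fun_eq_iff lag.coef_e unit_seq_def)

lemma power_series_coef:
  assumes "sq_integrable half_line g" "z \<in> unit_disc"
  shows "power_series (lag.coef g) z = pairing half_line g (eval_ker z)"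
proof (rule sums_unique2[OF power_series_sums[OF coef_l2[OF assms(1)] assms(2)]])
  show "(\<lambda>n. lag.coef g n * z ^ n) sums pairing half_line g (eval_ker z)"
    using pairing_eval_ker_sums[of z g] assms by (simp add: mult.commute)
qed

definition mult_matrix :: "(real \<Rightarrow> complex) \<Rightarrow> nat \<Rightarrow> nat \<Rightarrow> complex" where
  "mult_matrix h j k = lag.coef (\<lambda>x. h x * lag j x) k"

text \<open>Bessel's inequality for h times a finite combination of Laguerre functions bounds the
  finite sections; B is squared because \<open>bound\<close> compares squared norms.\<close>

lemma bounded_symmetric_mult_matrix:
  assumes h: "h \<in> borel_measurable half_line" "\<And>x. 0 < x \<Longrightarrow> cmod (h x) \<le> B"
  shows "bounded_symmetric_matrix (mult_matrix h) (B\<^sup>2)"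
proof
  have le: "x \<in> space half_line \<Longrightarrow> cmod (h x) \<le> B" for x
    using h(2) by (simp add: space_restrict_space)
  note sq = sq_integrable_mult_bounded[OF _ h(1) le]
  show sym: "mult_matrix h j k = mult_matrix h k j" for j k
    by (simp add: mult_matrix_def lag.coef_def pairing_def mult_ac)
  fix J N a
  let ?g = "\<lambda>x. \<Sum>k<N. a k * lag k x"
  have g: "sq_integrable half_line ?g"
    by (intro sq_integrable_sum sq_integrable_cmult sq_integrable_lag)
  have "(\<Sum>k<N. mult_matrix h j k * a k) = lag.coef (\<lambda>x. h x * ?g x) j" for j
  proof -
    have "lag.coef (\<lambda>x. h x * ?g x) j = pairing half_line (\<lambda>x. \<Sum>k<N. a k * (h x * lag k x)) (lag j)"
      by (simp add: lag.coef_def sum_distrib_left mult_ac)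
    also have "\<dots> = (\<Sum>k<N. a k * pairing half_line (\<lambda>x. h x * lag k x) (lag j))"
      by (rule pairing_sum_left) (auto intro: sq sq_integrable_lag)
    also have "\<dots> = (\<Sum>k<N. mult_matrix h j k * a k)"
      by (simp add: sym[of j] mult.commute) (simp add: mult_matrix_def lag.coef_def)
    finally show ?thesis ..
  qed
  then have "(\<Sum>j<J. (cmod (\<Sum>k<N. mult_matrix h j k * a k))\<^sup>2) \<le> sq_norm half_line (\<lambda>x. h x * ?g x)"
    using lag.Bessel[OF sq(1)[OF g]] by simp
  also have "\<dots> \<le> B\<^sup>2 * sq_norm half_line ?g"
    by (rule sq(2)[OF g])
  finally show "(\<Sum>j<J. (cmod (\<Sum>k<N. mult_matrix h j k * a k))\<^sup>2) \<le> B\<^sup>2 * (\<Sum>k<N. (cmod (a k))\<^sup>2)"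
    by (simp only: lag.sq_norm_finite_combination)
qed

lemma mat_app_unit_seq: "mat_app m (unit_seq n) j = m j n"
  by (simp add: mat_app_def dot_unit_seq[unfolded dot_def])

text \<open>By symmetry the matrix may act on the sequence z^n instead of a. That sequence consists
  of the coefficients of \<open>eval_ker z\<close>, for which Parseval's identity is available, so
  the multiplication by h can be carried out on the kernel itself.\<close>

lemma power_series_mult_matrix:
  assumes h: "h \<in> borel_measurable half_line" "\<And>x. 0 < x \<Longrightarrow> cmod (h x) \<le> B"
    and a: "a \<in> l2" and z: "z \<in> unit_disc"
  shows "power_series (mat_app (mult_matrix h) a) z = dot a (lag.coef (\<lambda>x. h x * eval_ker z x))"
proof -
  interpret m: bounded_symmetric_matrix "mult_matrix h" "B\<^sup>2"
    by (rule bounded_symmetric_mult_matrix[OF h])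
  have zn: "cmod z < 1" using z by simp
  have le: "x \<in> space half_line \<Longrightarrow> cmod (h x) \<le> B" for x
    using h(2) by (simp add: space_restrict_space)
  note sq = sq_integrable_mult_bounded(1)[OF _ h(1) le]
  have "power_series (mat_app (mult_matrix h) a) z = dot a (mat_app (mult_matrix h) (\<lambda>n. z ^ n))"
    using z by (simp add: power_series_def m.dot_mat_app a l2_power)
  also have "mat_app (mult_matrix h) (\<lambda>n. z ^ n) = lag.coef (\<lambda>x. h x * eval_ker z x)"
  proof
    fix j
    have "(\<lambda>k. z ^ k * lag.coef (\<lambda>x. h x * lag j x) k) sums pairing half_line (\<lambda>x. h x * lag j x) (eval_ker z)"
      by (intro pairing_eval_ker_sums zn sq sq_integrable_lag)
    then have "mat_app (mult_matrix h) (\<lambda>n. z ^ n) j = pairing half_line (\<lambda>x. h x * lag j x) (eval_ker z)"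
      by (simp add: mat_app_def mult_matrix_def sums_iff mult.commute)
    then show "mat_app (mult_matrix h) (\<lambda>n. z ^ n) j = lag.coef (\<lambda>x. h x * eval_ker z x) j"
      by (simp add: lag.coef_def pairing_def mult_ac)
  qed
  finally show ?thesis .
qed

section \<open>The weighted composition operator as multiplication by an exponential symbol\<close>

lemma cmod_exp_diff_le:
  assumes "0 \<le> Re \<tau>" "0 \<le> s" "s \<le> x"
  shows "cmod (exp (- (of_real s * \<tau>)) - exp (- (of_real x * \<tau>))) \<le> cmod \<tau> * (x - s)"
proof -
  have "cmod (exp (- (of_real s * \<tau>)) - exp (- (of_real x * \<tau>))) \<le> cmod \<tau> * cmod (of_real s - of_real x)"
  proof (rule field_differentiable_bound[where S = "of_real ` {0..}" and f' = "\<lambda>u. - \<tau> * exp (- (u * \<tau>))"])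
    show "convex (complex_of_real ` {0..})"
      by (intro convex_linear_image) (auto intro: linearI simp: scaleR_conv_of_real)
    show "((\<lambda>u. exp (- (u * \<tau>))) has_field_derivative - \<tau> * exp (- (u * \<tau>))) (at u within S)" for u S
      by (auto intro!: derivative_eq_intros)
    show "cmod (- \<tau> * exp (- (u * \<tau>))) \<le> cmod \<tau>" if "u \<in> complex_of_real ` {0..}" for u
      using that assms(1) by (auto simp: norm_mult intro!: mult_left_le)
  qed (use assms in auto)
  also have "cmod (of_real s - of_real x) = x - s"
    using assms by (simp flip: of_real_diff)
  finally show ?thesis .
qed

text \<open>These properties are all that the spectral computation uses of the composed map and
  weight. In the theorem \<open>C\<close> becomes \<open>c * D\<close> and \<open>\<tau>\<close>
  becomes \<open>t + t'\<close>.\<close>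

locale parabolic_weighted_comp =
  fixes \<psi> \<phi> :: "complex \<Rightarrow> complex" and C \<tau> :: complex
  assumes self_map: "z \<in> unit_disc \<Longrightarrow> \<phi> z \<in> unit_disc"
    and translation: "z \<in> unit_disc \<Longrightarrow> cayley (\<phi> z) = cayley z + \<tau>"
    and weight: "z \<in> unit_disc \<Longrightarrow> \<psi> z = C * (1 - \<phi> z) / (1 - z)"
    and Re_pos: "0 < Re \<tau>"
begin

abbreviation W :: "(complex \<Rightarrow> complex) \<Rightarrow> complex \<Rightarrow> complex" where
  "W \<equiv> weighted_comp \<psi> \<phi>"

definition symbol :: "complex \<Rightarrow> real \<Rightarrow> complex" where
  "symbol l x = C * exp (- (of_real x * \<tau>)) - l"

lemma symbol_measurable: "symbol l \<in> borel_measurable half_line"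
  unfolding symbol_def[abs_def] by (intro half_line_measurable borel_measurable_continuous_onI continuous_intros)

lemma cmod_symbol_le: "0 < x \<Longrightarrow> cmod (symbol l x) \<le> cmod C + cmod l"
  unfolding symbol_def using Re_pos
  by (intro order_trans[OF norm_triangle_ineq4] add_right_mono) (auto simp: norm_mult intro!: mult_left_le)

text \<open>The numerator \<open>1 - \<phi> z\<close> of the weight cancels the denominator of the
  kernel at \<open>\<phi> z\<close>, and the translation contributes exactly the exponential in the
  symbol.\<close>

lemma symbol_eval_ker:
  assumes "z \<in> unit_disc"
  shows "symbol l x * eval_ker z x = \<psi> z * eval_ker (\<phi> z) x - l * eval_ker z x"
proof -
  have "1 - z \<noteq> 0" "1 - \<phi> z \<noteq> 0" using assms self_map[OF assms] by auto
  moreover have "exp (- ((cayley z + \<tau>) * of_real x)) = exp (- (cayley z * of_real x)) * exp (- (of_real x * \<tau>))"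
    by (simp add: algebra_simps flip: exp_add)
  ultimately have "\<psi> z * eval_ker (\<phi> z) x = C * exp (- (of_real x * \<tau>)) * eval_ker z x"
    using assms by (simp add: eval_ker_def weight translation)
  then show ?thesis
    by (simp add: symbol_def algebra_simps)
qed

lemma sq_integrable_symbol: "sq_integrable half_line g \<Longrightarrow> sq_integrable half_line (\<lambda>x. symbol l x * g x)"
  using cmod_symbol_le
  by (intro sq_integrable_mult_bounded(1)[OF _ symbol_measurable]) (auto simp: space_restrict_space)

sublocale symbol: bounded_symmetric_matrix "mult_matrix (symbol l)" "(cmod C + cmod l)\<^sup>2" for l
  by (rule bounded_symmetric_mult_matrix[OF symbol_measurable cmod_symbol_le])

lemma W_power_series:
  assumes a: "a \<in> l2"
  shows "(\<lambda>z. W (power_series a) z - l * power_series a z) = power_series (mat_app (mult_matrix (symbol l)) a)"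
proof
  fix z
  show "W (power_series a) z - l * power_series a z = power_series (mat_app (mult_matrix (symbol l)) a) z"
  proof (cases "z \<in> unit_disc")
    case True
    have z: "cmod z < 1" "cmod (\<phi> z) < 1" using True self_map[OF True] by auto
    have "lag.coef (\<lambda>x. symbol l x * eval_ker z x) = (\<lambda>n. \<psi> z * \<phi> z ^ n - l * z ^ n)"
    proof
      fix n
      have "lag.coef (\<lambda>x. symbol l x * eval_ker z x) n = \<psi> z * lag.coef (eval_ker (\<phi> z)) n - l * lag.coef (eval_ker z) n"
        unfolding symbol_eval_ker[OF True] lag.coef_def using z
        by (subst pairing_diff_left)
           (auto intro: sq_integrable_cmult sq_integrable_eval_ker sq_integrable_lag simp: pairing_cmult_left)
      then show "lag.coef (\<lambda>x. symbol l x * eval_ker z x) n = \<psi> z * \<phi> z ^ n - l * z ^ n"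
        using z by (simp add: coef_eval_ker)
    qed
    then have "power_series (mat_app (mult_matrix (symbol l)) a) z = dot a (\<lambda>n. \<psi> z * \<phi> z ^ n - l * z ^ n)"
      using power_series_mult_matrix[OF symbol_measurable cmod_symbol_le a True, of l] by simp
    also have "\<dots> = \<psi> z * dot a (\<lambda>n. \<phi> z ^ n) - l * dot a (\<lambda>n. z ^ n)"
      using a z by (simp add: dot_diff_right dot_cmult_right l2_cmult l2_power)
    finally show ?thesis
      using True self_map[OF True] by (simp add: weighted_comp_def power_series_def)
  qed (simp add: weighted_comp_def power_series_def)
qed

text \<open>The counterpart of \<open>W_power_series\<close> for sequences that come from a function
  g: values are pairings of g with kernels, so under the integral the symbol moves from the kernel
  to g.\<close>

lemma W_power_series_coef:
  assumes g: "sq_integrable half_line g"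
  shows "(\<lambda>z. W (power_series (lag.coef g)) z - l * power_series (lag.coef g) z)
      = power_series (lag.coef (\<lambda>x. symbol l x * g x))"
proof
  fix z
  show "W (power_series (lag.coef g)) z - l * power_series (lag.coef g) z
      = power_series (lag.coef (\<lambda>x. symbol l x * g x)) z"
  proof (cases "z \<in> unit_disc")
    case True
    have z: "cmod z < 1" "cmod (\<phi> z) < 1" using True self_map[OF True] by auto
    have "power_series (lag.coef (\<lambda>x. symbol l x * g x)) z = pairing half_line (\<lambda>x. symbol l x * eval_ker z x) g"
      unfolding power_series_coef[OF sq_integrable_symbol[OF g] True] by (simp add: pairing_def mult_ac)
    also have "\<dots> = \<psi> z * pairing half_line g (eval_ker (\<phi> z)) - l * pairing half_line g (eval_ker z)"
      unfolding symbol_eval_ker[OF True] using z g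
      by (subst pairing_diff_left)
         (auto intro: sq_integrable_cmult sq_integrable_eval_ker simp: pairing_cmult_left pairing_commute[of _ g])
    finally show ?thesis
      using True self_map[OF True] g by (simp add: weighted_comp_def power_series_coef)
  qed (simp add: weighted_comp_def power_series_def)
qed

text \<open>For a general multiplier this would call for expanding g in Laguerre functions. Here the
  two descriptions of \<open>W - l\<close> show that both sides generate the same H2 function, and a
  power series determines its coefficients.\<close>

lemma mat_app_symbol_coef:
  assumes g: "sq_integrable half_line g"
  shows "mat_app (mult_matrix (symbol l)) (lag.coef g) = lag.coef (\<lambda>x. symbol l x * g x)"
  using W_power_series[OF coef_l2[OF g], of l] W_power_series_coef[OF g, of l]
  by (intro power_series_inject) (auto intro: symbol.mat_app_l2 coef_l2 sq_integrable_symbol g)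

text \<open>Multiplication by the reciprocal of the symbol inverts \<open>W - l\<close>: on one side by computation, on
  the other because multiplication matrices are symmetric, so that completeness of the Laguerre
  functions is not needed.\<close>

lemma resolvent:
  assumes r: "\<And>x. 0 < x \<Longrightarrow> r \<le> cmod (symbol l x)" "0 < r"
  shows "l \<notin> H2_spectrum W"
proof -
  define h where "h x = inverse (symbol l x)" for x
  have h: "h \<in> borel_measurable half_line"
    unfolding h_def[abs_def] using symbol_measurable[of l] by measurable
  have hB: "cmod (h x) \<le> 1 / r" if "0 < x" for x
    using le_imp_inverse_le[OF r(1)[OF that] r(2)] by (simp add: h_def inverse_eq_divide norm_divide)
  interpret h: bounded_symmetric_matrix "mult_matrix h" "(1 / r)\<^sup>2"
    by (rule bounded_symmetric_mult_matrix[OF h hB])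
  let ?m = "mult_matrix (symbol l)" and ?h = "mult_matrix h"
  have mh: "mat_app ?m (mat_app ?h (unit_seq n)) = unit_seq n" for n
  proof -
    have s: "sq_integrable half_line (\<lambda>x. h x * lag n x)"
      using hB by (intro sq_integrable_mult_bounded(1)[OF sq_integrable_lag h]) (auto simp: space_restrict_space)
    have "mat_app ?h (unit_seq n) = lag.coef (\<lambda>x. h x * lag n x)"
      by (simp add: fun_eq_iff mat_app_unit_seq h.symmetric[of _ n]) (simp add: mult_matrix_def)
    then have "mat_app ?m (mat_app ?h (unit_seq n)) = lag.coef (\<lambda>x. symbol l x * (h x * lag n x))"
      by (simp add: mat_app_symbol_coef s)
    also have "\<dots> = lag.coef (lag n)"
    proof -
      have "symbol l x * (h x * lag n x) = lag n x" if "0 < x" for x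
      proof -
        have "symbol l x \<noteq> 0" using r(1)[OF that] r(2) by auto
        then show ?thesis by (simp add: h_def)
      qed
      then show ?thesis
        unfolding lag.coef_def pairing_def
        by (intro ext Bochner_Integration.integral_cong refl) (auto simp: space_restrict_space)
    qed
    finally show ?thesis by (simp add: coef_lag)
  qed
  note mB = symbol.bounded_symmetric_matrix_axioms[of l] and hB' = h.bounded_symmetric_matrix_axioms
  have hm: "mat_app ?h (mat_app ?m a) = a" if "a \<in> l2" for a
    by (rule mat_app_left_inverse[OF mB hB' mh that])
  \<comment> \<open>A second transposition extends \<open>mh\<close> from the unit sequences to all
    of l2.\<close>
  have mh': "mat_app ?m (mat_app ?h a) = a" if "a \<in> l2" for a
    by (rule mat_app_left_inverse[OF hB' mB hm[OF l2_unit_seq] that])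
  define S where "S f = power_series (mat_app ?h (taylor_coeff f))" for f
  have S: "S (power_series a) = power_series (mat_app ?h a)" if "a \<in> l2" for a
    using that by (simp add: S_def taylor_coeff_power_series)
  have "H2_bounded_operator S"
    unfolding H2_bounded_operator_def
  proof (intro conjI ballI allI)
    show "S f \<in> H2" if f: "f \<in> H2" for f
    proof -
      obtain a where a: "a \<in> l2" "f = power_series a" by (rule H2E[OF f])
      show ?thesis
        unfolding a(2) S[OF a(1)] by (rule power_series_H2[OF h.mat_app_l2[OF a(1)]])
    qed
    show "S (\<lambda>z. f z + g z) = (\<lambda>z. S f z + S g z)" if fg: "f \<in> H2" "g \<in> H2" for f g
    proof -
      obtain a where a: "a \<in> l2" "f = power_series a" by (rule H2E[OF fg(1)])
      obtain b where b: "b \<in> l2" "g = power_series b" by (rule H2E[OF fg(2)])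
      show ?thesis
        unfolding a b power_series_add[OF a(1) b(1), symmetric] S[OF a(1)] S[OF b(1)]
          S[OF l2_add(1)[OF a(1) b(1)]] h.mat_app_add[OF a(1) b(1)]
        by (rule power_series_add[OF h.mat_app_l2[OF a(1)] h.mat_app_l2[OF b(1)]])
    qed
    show "S (\<lambda>z. k * f z) = (\<lambda>z. k * S f z)" if f: "f \<in> H2" for k f
    proof -
      obtain a where a: "a \<in> l2" "f = power_series a"
        by (rule H2E[OF f])
      show ?thesis
        unfolding a power_series_cmult[OF a(1), symmetric] S[OF a(1)]
          S[OF l2_cmult(1)[OF a(1)]] h.mat_app_cmult[OF a(1)]
        by (rule power_series_cmult[OF h.mat_app_l2[OF a(1)]])
    qed
    show "\<exists>K. \<forall>f\<in>H2. H2_norm (S f) \<le> K * H2_norm f"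
    proof (intro exI ballI)
      fix f assume "f \<in> H2"
      then obtain a where a: "a \<in> l2" "f = power_series a" by (rule H2E)
      have "sqrt (l2_sq (mat_app ?h a)) \<le> sqrt ((1 / r)\<^sup>2 * l2_sq a)"
        using h.mat_app_bound[OF a(1)] by simp
      then show "H2_norm (S f) \<le> (1 / r) * H2_norm f"
        using r(2) by (simp add: a S H2_norm_power_series h.mat_app_l2 real_sqrt_mult real_sqrt_divide)
    qed
  qed
  moreover have "S (\<lambda>z. W f z - l * f z) = f" if f: "f \<in> H2" for f
  proof -
    obtain a where a: "a \<in> l2" "f = power_series a" by (rule H2E[OF f])
    show ?thesis
      unfolding a W_power_series[OF a(1)] by (simp add: S symbol.mat_app_l2 a hm)
  qed
  moreover have "(\<lambda>z. W (S f) z - l * S f z) = f" if f: "f \<in> H2" for f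
  proof -
    obtain a where a: "a \<in> l2" "f = power_series a" by (rule H2E[OF f])
    show ?thesis
      unfolding a S[OF a(1)] W_power_series[OF h.mat_app_l2[OF a(1)]] by (simp add: a mh')
  qed
  ultimately show ?thesis
    unfolding H2_spectrum_def by blast
qed

text \<open>Take for \<open>g\<close> the indicator of a short interval \<open>(s, s + \<epsilon>)\<close>: its zeroth coefficient is of order
  \<open>\<epsilon>\<close>, so the right-hand side is at least of order \<open>\<epsilon>\<^sup>2\<close>, whereas the symbol is \<open>O(\<epsilon>)\<close> there, so the
  left-hand side is of order \<open>\<epsilon>\<^sup>3\<close>.\<close>

lemma approximate_eigenvector:
  assumes s: "0 \<le> s"
  obtains g where "sq_integrable half_line g"
    "K * l2_sq (lag.coef (\<lambda>x. symbol (C * exp (- (of_real s * \<tau>))) x * g x)) < l2_sq (lag.coef g)"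
proof -
  let ?l = "C * exp (- (of_real s * \<tau>))"
  \<comment> \<open>L times the cube of \<epsilon> will bound the left-hand side from above, c times
    its square the right-hand side from below, so the aim is \<open>\<epsilon> * L < c\<close>. The
    constant c is the square of \<open>lag 0\<close> at s + 1, and \<epsilon> \<le> 1 keeps the
    interval below that point. The denominator \<open>L + 1\<close> covers L = 0.\<close>
  define L where "L = \<bar>K\<bar> * (cmod C * cmod \<tau>)\<^sup>2"
  define c where "c = (sqrt 2 * exp (- (s + 1)))\<^sup>2"
  define \<epsilon> where "\<epsilon> = min 1 (c / (L + 1))"
  have L: "L \<ge> 0" by (simp add: L_def)
  have c: "c > 0" by (simp add: c_def)
  have e: "0 < \<epsilon>" "\<epsilon> \<le> 1" using L c by (auto simp: \<epsilon>_def)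
  have "\<epsilon> * L < c"
  proof (cases "L = 0")
    case False
    have "\<epsilon> * L \<le> c / (L + 1) * L" using L by (intro mult_right_mono) (auto simp: \<epsilon>_def)
    also have "\<dots> < c" using L c False by (simp add: field_simps)
    finally show ?thesis .
  qed (use c in simp)
  let ?I = "{s<..<s+\<epsilon>}"
  define g :: "real \<Rightarrow> complex" where "g x = indicator ?I x" for x
  have int: "integrable half_line (indicator ?I :: real \<Rightarrow> real)" "(LINT x|half_line. indicator ?I x) = \<epsilon>"
  proof -
    have eq: "indicator {0<..} x *\<^sub>R indicator ?I x = (indicator ?I x :: real)" for x :: real
      using s by (auto simp: indicator_def)
    show "integrable half_line (indicator ?I :: real \<Rightarrow> real)"
      by (subst integrable_restrict_space, simp, subst eq, rule integrable_real_indicator) (use e in simp_all)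
    show "(LINT x|half_line. indicator ?I x) = \<epsilon>"
      by (subst integral_restrict_space, simp, subst eq) (use e in simp)
  qed
  have g_sq: "(cmod (g x))\<^sup>2 = indicator ?I x" for x
    by (simp add: g_def indicator_def)
  have g: "sq_integrable half_line g"
    unfolding sq_integrable_def g_sq using int(1)
    by (auto simp: g_def[abs_def] intro!: half_line_measurable)
  have sym: "cmod (symbol ?l x * g x) \<le> cmod C * cmod \<tau> * \<epsilon> * indicator ?I x" for x
  proof (cases "x \<in> ?I")
    case True
    have "symbol ?l x = - (C * (exp (- (of_real s * \<tau>)) - exp (- (of_real x * \<tau>))))"
      by (simp add: symbol_def algebra_simps)
    then have "cmod (symbol ?l x) = cmod C * cmod (exp (- (of_real s * \<tau>)) - exp (- (of_real x * \<tau>)))"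
      by (simp only: norm_minus_cancel norm_mult)
    also have "\<dots> \<le> cmod C * (cmod \<tau> * (x - s))"
      using True s Re_pos by (intro mult_left_mono cmod_exp_diff_le) auto
    also have "\<dots> \<le> cmod C * (cmod \<tau> * \<epsilon>)"
      using True by (intro mult_left_mono) auto
    finally show ?thesis using True by (simp add: g_def norm_mult)
  qed (simp add: g_def)
  have "l2_sq (lag.coef (\<lambda>x. symbol ?l x * g x)) \<le> sq_norm half_line (\<lambda>x. symbol ?l x * g x)"
    by (intro l2_sq_coef sq_integrable_symbol g)
  also have "\<dots> \<le> (LINT x|half_line. (cmod C * cmod \<tau> * \<epsilon>)\<^sup>2 * indicator ?I x)"
    unfolding sq_norm_def
  proof (intro integral_mono)
    show "integrable half_line (\<lambda>x. (cmod (symbol ?l x * g x))\<^sup>2)"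
      using sq_integrable_symbol[OF g] by (simp add: sq_integrable_def)
    show "integrable half_line (\<lambda>x. (cmod C * cmod \<tau> * \<epsilon>)\<^sup>2 * indicator ?I x)"
      using int by (intro integrable_mult_right) auto
    fix x
    show "(cmod (symbol ?l x * g x))\<^sup>2 \<le> (cmod C * cmod \<tau> * \<epsilon>)\<^sup>2 * indicator ?I x"
      using power_mono[OF sym[of x], of 2] by (auto simp: power_mult_distrib indicator_def split: if_splits)
  qed
  also have "\<dots> = (cmod C * cmod \<tau> * \<epsilon>)\<^sup>2 * \<epsilon>"
    by (simp only: integral_mult_right_zero int(2))
  finally have up: "l2_sq (lag.coef (\<lambda>x. symbol ?l x * g x)) \<le> (cmod C * cmod \<tau> * \<epsilon>)\<^sup>2 * \<epsilon>" .
  \<comment> \<open>Bessel gives only upper bounds for \<open>l2_sq (lag.coef g)\<close>. The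
    coefficient at 0 is accessible because \<open>lag 0 x\<close> is sqrt 2 exp (- x), positive and
    decreasing.\<close>
  have low: "sqrt 2 * exp (- (s + 1)) * \<epsilon> \<le> cmod (lag.coef g 0)"
  proof -
    have e0: "g x * lag 0 x = complex_of_real (sqrt 2 * exp (- x) * indicator ?I x)" for x
      by (simp add: g_def lag_def lag_coeff_def indicator_def exp_of_real[symmetric])
    have i: "integrable half_line (\<lambda>x. sqrt 2 * exp (- x) * indicator ?I x)"
      using integrable_mult_sq_integrable[OF g sq_integrable_lag[of 0]] 
      unfolding e0 complex_of_real_integrable_eq .
    have "sqrt 2 * exp (- (s + 1)) * \<epsilon> = (LINT x|half_line. sqrt 2 * exp (- (s + 1)) * indicator ?I x)"
      by (simp only: integral_mult_right_zero int(2))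
    also have "\<dots> \<le> (LINT x|half_line. sqrt 2 * exp (- x) * indicator ?I x)"
    proof (rule integral_mono[OF _ i])
      show "integrable half_line (\<lambda>x. sqrt 2 * exp (- (s + 1)) * indicator ?I x)"
        using int by (intro integrable_mult_right) auto
    qed (use e in \<open>auto simp: indicator_def\<close>)
    also have "\<dots> \<le> cmod (complex_of_real (LINT x|half_line. sqrt 2 * exp (- x) * indicator ?I x))"
      by simp
    also have "complex_of_real (LINT x|half_line. sqrt 2 * exp (- x) * indicator ?I x) = lag.coef g 0"
      unfolding lag.coef_def pairing_def e0 by (rule integral_complex_of_real[symmetric])
    finally show ?thesis .
  qed
  have "K * l2_sq (lag.coef (\<lambda>x. symbol ?l x * g x)) \<le> \<bar>K\<bar> * ((cmod C * cmod \<tau> * \<epsilon>)\<^sup>2 * \<epsilon>)"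
    using up l2_sq_nonneg[OF coef_l2[OF sq_integrable_symbol[OF g]], of ?l]
    by (intro mult_mono) auto
  also have "\<dots> = (\<epsilon> * L) * \<epsilon>\<^sup>2"
    by (simp add: L_def power_mult_distrib)
  also have "\<dots> < c * \<epsilon>\<^sup>2"
    using \<open>\<epsilon> * L < c\<close> e by simp
  also have "\<dots> = (sqrt 2 * exp (- (s + 1)) * \<epsilon>)\<^sup>2"
    by (simp add: c_def power_mult_distrib)
  also have "\<dots> \<le> (cmod (lag.coef g 0))\<^sup>2"
    using low e by (intro power_mono) auto
  also have "\<dots> = (\<Sum>n<1. (cmod (lag.coef g n))\<^sup>2)" by simp
  also have "\<dots> \<le> l2_sq (lag.coef g)"
    unfolding l2_sq_def using coef_l2[OF g] by (intro sum_le_suminf) (auto simp: l2_def)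
  finally show ?thesis using that g by blast
qed

text \<open>A bounded inverse recovers f from (W - l) f, so its norm bound is a lower bound for W -
  l; the constant gets squared since \<open>l2_sq\<close> is a squared norm.\<close>

lemma bounded_below_if_not_in_spectrum:
  assumes "l \<notin> H2_spectrum W"
  obtains K where "\<And>g. sq_integrable half_line g \<Longrightarrow>
    l2_sq (lag.coef g) \<le> K * l2_sq (lag.coef (\<lambda>x. symbol l x * g x))"
proof -
  obtain S where S: "H2_bounded_operator S" "\<And>f. f \<in> H2 \<Longrightarrow> S (\<lambda>z. W f z - l * f z) = f"
    using assms by (auto simp: H2_spectrum_def)
  then obtain K where K: "\<And>f. f \<in> H2 \<Longrightarrow> H2_norm (S f) \<le> K * H2_norm f"
    unfolding H2_bounded_operator_def by blast
  show ?thesis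
  proof (rule that[of "K\<^sup>2"])
    fix g assume g: "sq_integrable half_line g"
    let ?a = "lag.coef g" and ?b = "lag.coef (\<lambda>x. symbol l x * g x)"
    have ab: "?a \<in> l2" "?b \<in> l2"
      by (intro coef_l2 sq_integrable_symbol g)+
    have "S (power_series ?b) = power_series ?a"
      using S(2)[OF power_series_H2[OF ab(1)]] by (simp only: W_power_series_coef[OF g])
    then have "sqrt (l2_sq ?a) \<le> K * sqrt (l2_sq ?b)"
      using K[OF power_series_H2[OF ab(2)]] ab by (simp add: H2_norm_power_series)
    then have "(sqrt (l2_sq ?a))\<^sup>2 \<le> (K * sqrt (l2_sq ?b))\<^sup>2"
      using l2_sq_nonneg[OF ab(1)] by (intro power_mono) auto
    then show "l2_sq ?a \<le> K\<^sup>2 * l2_sq ?b"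
      using ab by (simp add: power_mult_distrib l2_sq_nonneg)
  qed
qed

lemma curve_in_spectrum: "0 \<le> s \<Longrightarrow> C * exp (- (of_real s * \<tau>)) \<in> H2_spectrum W"
proof (rule ccontr)
  assume s: "0 \<le> s" and "C * exp (- (of_real s * \<tau>)) \<notin> H2_spectrum W"
  then obtain K where K: "\<And>g. sq_integrable half_line g \<Longrightarrow>
    l2_sq (lag.coef g) \<le> K * l2_sq (lag.coef (\<lambda>x. symbol (C * exp (- (of_real s * \<tau>))) x * g x))"
    using bounded_below_if_not_in_spectrum by blast
  obtain g where g: "sq_integrable half_line g"
    "K * l2_sq (lag.coef (\<lambda>x. symbol (C * exp (- (of_real s * \<tau>))) x * g x)) < l2_sq (lag.coef g)"
    by (rule approximate_eigenvector[OF s])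
  with K[OF g(1)] show False by simp
qed

lemma symbol_tendsto: "(symbol l \<longlongrightarrow> - l) at_top"
proof -
  have "((\<lambda>x. C * (of_real x ^ 0 * exp (- (\<tau> * of_real x))) - l) \<longlongrightarrow> C * 0 - l) at_top"
    using Re_pos by (intro tendsto_intros power_times_exp_tendsto_0)
  then show ?thesis by (simp add: symbol_def[abs_def] mult.commute)
qed

text \<open>0 is a limit of values of the symbol, so this is closedness of the spectrum by hand: an
  approximate eigenvector for a curve point l near 0 serves for 0 as well, up to an error of size
  |l|.\<close>

lemma zero_in_spectrum: "0 \<in> H2_spectrum W"
proof (rule ccontr)
  assume "0 \<notin> H2_spectrum W"
  then obtain K where K: "\<And>g. sq_integrable half_line g \<Longrightarrow>
    l2_sq (lag.coef g) \<le> K * l2_sq (lag.coef (\<lambda>x. symbol 0 x * g x))"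
    using bounded_below_if_not_in_spectrum by blast
  \<comment> \<open>The constants share out \<open>l2_sq ?a\<close>: the bound 1/2 on 2 |K| |l|^2
    absorbs one half of it, and the factor 4 |K| demanded of the approximate eigenvector keeps the
    other term below the second half.\<close>
  have "((\<lambda>x. 2 * \<bar>K\<bar> * (cmod (symbol 0 x))\<^sup>2) \<longlongrightarrow> 2 * \<bar>K\<bar> * (cmod (- 0))\<^sup>2) at_top"
    by (intro tendsto_intros symbol_tendsto)
  then have "\<forall>\<^sub>F x in at_top. 2 * \<bar>K\<bar> * (cmod (symbol 0 x))\<^sup>2 < 1/2"
    by (intro order_tendstoD(2)) auto
  then obtain s where s: "0 \<le> s" "2 * \<bar>K\<bar> * (cmod (symbol 0 s))\<^sup>2 < 1/2"
    using eventually_conj[OF _ eventually_ge_at_top[of 0], THEN eventually_happens] by fastforce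
  define l where "l = symbol 0 s"
  have l: "l = C * exp (- (of_real s * \<tau>))" by (simp add: l_def symbol_def)
  obtain g where g: "sq_integrable half_line g"
    "4 * \<bar>K\<bar> * l2_sq (lag.coef (\<lambda>x. symbol l x * g x)) < l2_sq (lag.coef g)"
    using approximate_eigenvector[OF s(1), of "4 * \<bar>K\<bar>"] unfolding l by blast
  let ?a = "lag.coef g" and ?b = "lag.coef (\<lambda>x. symbol l x * g x)" and ?c = "lag.coef (\<lambda>x. symbol 0 x * g x)"
  have abc: "?a \<in> l2" "?b \<in> l2" "?c \<in> l2"
    by (intro coef_l2 sq_integrable_symbol g)+
  have "?c n = ?b n + l * ?a n" for n
  proof -
    have "?b n = pairing half_line (\<lambda>x. symbol 0 x * g x - l * g x) (lag n)"
      by (simp add: lag.coef_def symbol_def algebra_simps)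
    also have "\<dots> = ?c n - l * ?a n"
      by (subst pairing_diff_left)
         (auto simp: lag.coef_def pairing_cmult_left intro: sq_integrable_symbol sq_integrable_cmult sq_integrable_lag g)
    finally show ?thesis by simp
  qed
  then have "?c = (\<lambda>n. ?b n + l * ?a n)" by blast
  then have "l2_sq ?c \<le> 2 * l2_sq ?b + 2 * ((cmod l)\<^sup>2 * l2_sq ?a)"
    using l2_add(2)[OF abc(2) l2_cmult(1)[OF abc(1), of l]] by (simp add: l2_cmult(2) abc)
  moreover have "l2_sq ?a \<le> \<bar>K\<bar> * l2_sq ?c"
    using order_trans[OF K[OF g(1)] mult_right_mono[OF abs_ge_self l2_sq_nonneg[OF abc(3)]]] .
  ultimately have "l2_sq ?a \<le> \<bar>K\<bar> * (2 * l2_sq ?b + 2 * ((cmod l)\<^sup>2 * l2_sq ?a))"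
    by (meson abs_ge_zero mult_left_mono order_trans)
  also have "\<dots> = 2 * \<bar>K\<bar> * l2_sq ?b + (2 * \<bar>K\<bar> * (cmod l)\<^sup>2) * l2_sq ?a"
    by (simp add: algebra_simps)
  also have "\<dots> \<le> 2 * \<bar>K\<bar> * l2_sq ?b + 1/2 * l2_sq ?a"
    using s(2) l2_sq_nonneg[OF abc(1)] unfolding l_def by (intro add_left_mono mult_right_mono) auto
  finally show False using g(2) by simp
qed

text \<open>Beyond some R the symbol is close to its nonzero limit -l; on the compact interval up to
  R its modulus attains a minimum, which is positive. \<open>max 0 R\<close> keeps that interval
  nonempty.\<close>

lemma symbol_bounded_below:
  assumes "l \<noteq> 0" "\<And>s. 0 \<le> s \<Longrightarrow> l \<noteq> C * exp (- (of_real s * \<tau>))"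
  obtains r where "0 < r" "\<And>x. 0 < x \<Longrightarrow> r \<le> cmod (symbol l x)"
proof -
  have "((\<lambda>x. cmod (symbol l x)) \<longlongrightarrow> cmod (- l)) at_top"
    by (intro tendsto_intros symbol_tendsto)
  then have "\<forall>\<^sub>F x in at_top. cmod l / 2 < cmod (symbol l x)"
    using assms(1) by (intro order_tendstoD(1)) auto
  then obtain R where R: "\<And>x. R \<le> x \<Longrightarrow> cmod l / 2 < cmod (symbol l x)"
    by (auto simp: eventually_at_top_linorder)
  have "continuous_on {0..max 0 R} (\<lambda>x. cmod (symbol l x))"
    unfolding symbol_def by (intro continuous_intros)
  then obtain y where y: "y \<in> {0..max 0 R}" "\<And>x. x \<in> {0..max 0 R} \<Longrightarrow> cmod (symbol l y) \<le> cmod (symbol l x)"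
    using continuous_attains_inf[of "{0..max 0 R}" "\<lambda>x. cmod (symbol l x)"] by fastforce
  show ?thesis
  proof (rule that[of "min (cmod (symbol l y)) (cmod l / 2)"])
    show "0 < min (cmod (symbol l y)) (cmod l / 2)"
      using assms y(1) by (auto simp: symbol_def)
    show "min (cmod (symbol l y)) (cmod l / 2) \<le> cmod (symbol l x)" if "0 < x" for x
      using that y(2)[of x] R[of x] by (cases "x \<le> R") auto
  qed
qed

lemma spectrum: "H2_spectrum W = {C * exp (- (of_real s * \<tau>)) | s :: real. s \<ge> 0} \<union> {0}"
proof
  show "H2_spectrum W \<subseteq> {C * exp (- (of_real s * \<tau>)) | s :: real. s \<ge> 0} \<union> {0}"
  proof
    fix l assume "l \<in> H2_spectrum W"
    then show "l \<in> {C * exp (- (of_real s * \<tau>)) | s :: real. s \<ge> 0} \<union> {0}"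
      using symbol_bounded_below[of l] resolvent[of _ l] by blast
  qed
qed (use curve_in_spectrum zero_in_spectrum in auto)

lemma spectral_radius: "H2_spectral_radius W = cmod C"
  unfolding H2_spectral_radius_def spectrum
proof (rule cSup_eq_maximum)
  show "cmod C \<in> cmod ` ({C * exp (- (of_real s * \<tau>)) | s :: real. s \<ge> 0} \<union> {0})"
    by (rule image_eqI[of _ _ C]) (auto intro!: exI[of _ 0])
  show "x \<le> cmod C" if "x \<in> cmod ` ({C * exp (- (of_real s * \<tau>)) | s :: real. s \<ge> 0} \<union> {0})" for x
    using that Re_pos by (auto simp: norm_mult intro!: mult_left_le)
qed

end

section \<open>Parabolic self-maps of the disc\<close>

lemma half_plane_map_1: "half_plane_map 1 = cayley"
  by (simp add: half_plane_map_def cayley_def fun_eq_iff)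

lemma cayley_inject: "z \<noteq> 1 \<Longrightarrow> y \<noteq> 1 \<Longrightarrow> cayley z = cayley y \<longleftrightarrow> z = y"
proof
  assume ne: "z \<noteq> 1" "y \<noteq> 1" and eq: "cayley z = cayley y"
  have "cayley u + 1 = 2 / (1 - u)" if "u \<noteq> 1" for u
    using that by (simp add: cayley_def add_divide_eq_iff field_simps)
  with ne eq have "2 / (1 - z) = 2 / (1 - y)" by metis
  with ne show "z = y" by simp
qed simp

lemma cmod_less_1_if_Re_cayley_pos:
  assumes "z \<noteq> 1" "0 < Re (cayley z)"
  shows "cmod z < 1"
proof -
  have "0 < 1 - (cmod z)\<^sup>2"
    using assms by (simp add: Re_cayley zero_less_divide_iff)
  then show ?thesis by (simp add: power_less_one_iff)
qed

lemma cayley_surj: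
  assumes "0 < Re w"
  obtains z where "z \<in> unit_disc" "cayley z = w"
proof -
  have w: "w + 1 \<noteq> 0" using assms by (auto simp: complex_eq_iff)
  define z where "z = (w - 1) / (w + 1)"
  have "1 - z = 2 / (w + 1)" "1 + z = 2 * w / (w + 1)"
    using w by (auto simp: z_def field_simps)
  then have c: "z \<noteq> 1" "cayley z = w"
    using w by (auto simp: cayley_def)
  with cmod_less_1_if_Re_cayley_pos assms show ?thesis
    by (intro that[of z]) auto
qed

text \<open>The inverse of an imaginary translation also preserves the right half-plane, which gives
  surjectivity. Contrapositively, a composed map that is no automorphism translates by a number with
  nonzero real part.\<close>

lemma disc_automorphism_if_imaginary_translation:
  assumes f: "disc_self_map f" and t: "Re t = 0"
    and translation: "\<And>z. z \<in> unit_disc \<Longrightarrow> cayley (f z) = cayley z + t"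
  shows "disc_automorphism f"
  unfolding disc_automorphism_def bij_betw_def
proof (intro conjI equalityI subsetI)
  show "f holomorphic_on unit_disc" using f by (simp add: disc_self_map_def)
  have ne: "z \<noteq> 1" if "z \<in> unit_disc" for z using that by auto
  have maps: "f z \<in> unit_disc" if "z \<in> unit_disc" for z
    using f that unfolding disc_self_map_def by blast
  show "inj_on f unit_disc"
  proof (rule inj_onI)
    fix x y assume "x \<in> unit_disc" "y \<in> unit_disc" "f x = f y"
    then have "cayley x = cayley y" "x \<noteq> 1" "y \<noteq> 1"
      using translation[of x] translation[of y] ne by auto
    then show "x = y" using cayley_inject by blast
  qed
  show "y \<in> unit_disc" if "y \<in> f ` unit_disc" for y
    using that maps by blast
  show "y \<in> f ` unit_disc" if y: "y \<in> unit_disc" for y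
  proof -
    have "0 < Re (cayley y - t)"
      using Re_cayley_pos[of y] y t by simp
    then obtain z where z: "z \<in> unit_disc" "cayley z = cayley y - t"
      by (rule cayley_surj)
    then have "cayley (f z) = cayley y"
      using translation[OF z(1)] by simp
    then have "f z = y"
      by (simp only: cayley_inject[OF ne[OF maps[OF z(1)]] ne[OF y]])
    with z(1) show ?thesis by blast
  qed
qed

text \<open>Since they fix \<open>1\<close>, the maps \<open>\<phi>\<close> and \<open>\<phi>p\<close> of the theorem are \<open>par a0\<close> and \<open>par (cnj p)\<close>.\<close>

definition par :: "complex \<Rightarrow> complex \<Rightarrow> complex" where
  "par q z = (q + (1 - 2 * q) * z) / (1 - q * z)"

lemma one_minus_mult_nonzero:
  fixes q z :: complex
  assumes "cmod q < 1" "cmod z \<le> 1"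
  shows "1 - q * z \<noteq> 0"
proof
  assume "1 - q * z = 0"
  then have "cmod q * cmod z = 1" by (metis eq_iff_diff_eq_0 norm_mult norm_one)
  moreover have "cmod q * cmod z \<le> cmod q * 1" using assms by (intro mult_left_mono) auto
  ultimately show False using assms by simp
qed

lemma one_minus_par:
  assumes "1 - q * z \<noteq> 0"
  shows "1 - par q z = (1 - q) * (1 - z) / (1 - q * z)"
proof -
  have "1 - par q z = ((1 - q * z) - (q + (1 - 2 * q) * z)) / (1 - q * z)"
    unfolding par_def diff_divide_distrib[of "1 - q * z"] using assms by simp
  also have "(1 - q * z) - (q + (1 - 2 * q) * z) = (1 - q) * (1 - z)"
    by (simp add: algebra_simps)
  finally show ?thesis .
qed

lemma par_ne_1:
  assumes "cmod q < 1" "z \<in> unit_disc"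
  shows "par q z \<noteq> 1"
proof -
  have "1 - q * z \<noteq> 0" using assms by (intro one_minus_mult_nonzero) auto
  moreover have "q \<noteq> 1" "z \<noteq> 1" using assms by auto
  ultimately show ?thesis using one_minus_par[of q z] by auto
qed

lemma cayley_par:
  assumes "cmod q < 1" "z \<in> unit_disc"
  shows "cayley (par q z) = cayley z + 2 * q / (1 - q)"
proof -
  have nz: "1 - q * z \<noteq> 0" using assms by (intro one_minus_mult_nonzero) auto
  have ne: "1 - q \<noteq> 0" "1 - z \<noteq> 0" using assms by auto
  have "1 + par q z = ((1 + q) + (1 - 3 * q) * z) / (1 - q * z)"
    using nz by (simp add: par_def field_simps)
  then have "cayley (par q z) = ((1 + q) + (1 - 3 * q) * z) / ((1 - q) * (1 - z))"
    using nz by (simp add: cayley_def one_minus_par)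
  also have "\<dots> = cayley z + 2 * q / (1 - q)"
    using ne by (simp add: cayley_def field_simps)
  finally show ?thesis .
qed

lemma disc_self_map_par:
  assumes f: "\<And>z. z \<in> unit_disc \<Longrightarrow> f z = par q z" and q: "cmod q < 1" and t: "0 \<le> Re (2 * q / (1 - q))"
  shows "disc_self_map f"
  unfolding disc_self_map_def
proof
  have "par q holomorphic_on unit_disc"
    unfolding par_def using one_minus_mult_nonzero[OF q] by (intro holomorphic_intros) auto
  then show "f holomorphic_on unit_disc"
    using f by (subst holomorphic_cong[OF refl]) auto
  show "f ` unit_disc \<subseteq> unit_disc"
  proof
    fix y assume "y \<in> f ` unit_disc"
    then obtain z where z: "z \<in> unit_disc" "y = par q z" using f by auto
    have "0 < Re (cayley (par q z))"
      unfolding cayley_par[OF q z(1)] using Re_cayley_pos[of z] z(1) t by simp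
    then show "y \<in> unit_disc"
      using cmod_less_1_if_Re_cayley_pos[OF par_ne_1[OF q z(1)]] z by simp
  qed
qed

text \<open>Points with \<open>cayley z = e\<close> for small e > 0 approach the boundary of the
  half-plane; their images stay inside it, so the real part of the translation exceeds -e.\<close>

lemma Re_translation_nonneg:
  assumes f: "\<And>z. z \<in> unit_disc \<Longrightarrow> f z = par q z" and q: "cmod q < 1" and self: "disc_self_map f"
  shows "0 \<le> Re (2 * q / (1 - q))"
proof (rule field_le_epsilon)
  fix e :: real assume "0 < e"
  then have "0 < Re (complex_of_real e)" by simp
  then obtain z where z: "z \<in> unit_disc" "cayley z = of_real e" by (rule cayley_surj)
  have "f z \<in> unit_disc" using self z(1) unfolding disc_self_map_def by blast
  then have "par q z \<in> unit_disc" by (simp only: f[OF z(1)])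
  then have "0 < Re (cayley (par q z))" by (intro Re_cayley_pos) simp
  then show "0 \<le> Re (2 * q / (1 - q)) + e"
    unfolding cayley_par[OF q z(1)] z(2) by simp
qed

text \<open>\<open>parabolic_at\<close> admits any coefficients that represent f on the disc, so the
  forward direction has to locate the fixed point from arbitrary ones. Uniqueness of \<zeta> is what
  makes the definite description in \<open>translation_number\<close> computable.\<close>

lemma parabolic_at_par_iff:
  assumes f: "\<And>z. z \<in> unit_disc \<Longrightarrow> f z = par q z" and q: "cmod q < 1" "q \<noteq> 0" and self: "disc_self_map f"
  shows "parabolic_at f \<zeta> \<longleftrightarrow> \<zeta> = 1"
proof
  assume "\<zeta> = 1"
  have q1: "1 - q \<noteq> 0" using q by auto
  have vals: "sphere_map (1 - 2 * q) q (- q) 1 (Some z) = Some (f z)" if "z \<in> unit_disc" for z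
    using one_minus_mult_nonzero[of q z] q that by (simp add: sphere_map_def f par_def add.commute)
  have det: "(1 - 2 * q) * 1 - q * (- q) \<noteq> 0"
  proof -
    have "(1 - 2 * q) * 1 - q * (- q) = (1 - q) * (1 - q)" by (simp add: algebra_simps)
    then show ?thesis using q1 by simp
  qed
  have fixed: "{x. sphere_map (1 - 2 * q) q (- q) 1 x = x} = {Some 1}"
  proof -
    have "sphere_map (1 - 2 * q) q (- q) 1 x = x \<longleftrightarrow> x = Some 1" for x
    proof (cases x)
      case None
      then show ?thesis using q by (simp add: sphere_map_def)
    next
      case (Some z)
      show ?thesis
      proof (cases "- q * z + 1 = 0")
        case True
        then have "z \<noteq> 1" using q1 by auto
        then show ?thesis using Some True by (simp add: sphere_map_def)
      next
        case False
        then have "sphere_map (1 - 2 * q) q (- q) 1 x = x \<longleftrightarrow> (1 - 2 * q) * z + q = z * (- q * z + 1)"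
          using Some by (simp add: sphere_map_def divide_eq_eq)
        \<comment> \<open>1 is a double root, hence the only finite fixed point; infinity is moved
          because q is nonzero.\<close>
        also have "\<dots> \<longleftrightarrow> q * ((z - 1) * (z - 1)) = 0"
          by (auto simp: algebra_simps)
        finally show ?thesis using q Some by auto
      qed
    qed
    then show ?thesis by blast
  qed
  have "\<exists>\<alpha> \<beta> \<gamma> \<delta>. \<alpha> * \<delta> - \<beta> * \<gamma> \<noteq> 0 \<and>
      (\<forall>z\<in>unit_disc. sphere_map \<alpha> \<beta> \<gamma> \<delta> (Some z) = Some (f z)) \<and>
      {x. sphere_map \<alpha> \<beta> \<gamma> \<delta> x = x} = {Some \<zeta>}"
    unfolding \<open>\<zeta> = 1\<close> by (intro exI) (rule conjI[OF det conjI[OF ballI[OF vals] fixed]])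
  then show "parabolic_at f \<zeta>"
    using self \<open>\<zeta> = 1\<close> by (simp add: parabolic_at_def)
next
  assume "parabolic_at f \<zeta>"
  then obtain \<alpha> \<beta> \<gamma> \<delta> where det: "\<alpha> * \<delta> - \<beta> * \<gamma> \<noteq> 0"
    and val: "\<And>z. z \<in> unit_disc \<Longrightarrow> sphere_map \<alpha> \<beta> \<gamma> \<delta> (Some z) = Some (f z)"
    and fixed: "{x. sphere_map \<alpha> \<beta> \<gamma> \<delta> x = x} = {Some \<zeta>}"
    unfolding parabolic_at_def by blast
  have eq: "(\<alpha> * z + \<beta>) * (1 - q * z) = (q + (1 - 2 * q) * z) * (\<gamma> * z + \<delta>)" if z: "z \<in> unit_disc" for z
  proof -
    have "1 - q * z \<noteq> 0" using one_minus_mult_nonzero[of q z] q z by simp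
    moreover have "\<gamma> * z + \<delta> \<noteq> 0" "(\<alpha> * z + \<beta>) / (\<gamma> * z + \<delta>) = par q z"
      using val[OF z] f[OF z] by (auto simp: sphere_map_def split: if_splits)
    ultimately show ?thesis by (simp add: par_def frac_eq_eq)
  qed
  \<comment> \<open>P vanishes on the open disc but is wanted at the boundary point 1. It has degree
    at most 2, so its third differences vanish; with step 1/2 from -1/2 this expresses P 1 through
    points of the disc.\<close>
  define P where "P z = (\<alpha> * z + \<beta>) * (1 - q * z) - (q + (1 - 2 * q) * z) * (\<gamma> * z + \<delta>)" for z
  have "P 1 = 3 * P (1/2) + P (- (1/2)) - 3 * P 0"
    by (simp add: P_def field_simps)
  moreover have "P (1/2) = 0" "P (- (1/2)) = 0" "P 0 = 0"
    unfolding P_def by (subst eq; simp)+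
  ultimately have "P 1 = 0" by simp
  then have "(1 - q) * (\<alpha> + \<beta>) = (1 - q) * (\<gamma> + \<delta>)"
    by (simp add: P_def algebra_simps)
  then have sum: "\<alpha> + \<beta> = \<gamma> + \<delta>" using q by auto
  \<comment> \<open>Otherwise numerator and denominator would both vanish at 1, against the
    determinant.\<close>
  have "\<gamma> + \<delta> \<noteq> 0"
  proof
    assume "\<gamma> + \<delta> = 0"
    with sum have "\<delta> = - \<gamma>" "\<beta> = - \<alpha>" by (simp_all add: eq_neg_iff_add_eq_0 add.commute)
    with det show False by simp
  qed
  with sum have "sphere_map \<alpha> \<beta> \<gamma> \<delta> (Some 1) = Some 1"
    by (simp add: sphere_map_def)
  then have "Some 1 \<in> {x. sphere_map \<alpha> \<beta> \<gamma> \<delta> x = x}" by simp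
  then show "\<zeta> = 1" unfolding fixed by simp
qed

lemma parabolic_if_par:
  assumes f: "\<And>z. z \<in> unit_disc \<Longrightarrow> f z = par q z" and q: "cmod q < 1" "q \<noteq> 0" and self: "disc_self_map f"
  shows "parabolic f"
  unfolding parabolic_def by (rule exI, rule iffD2[OF parabolic_at_par_iff[OF f q self] refl])

lemma translation_number_par:
  assumes f: "\<And>z. z \<in> unit_disc \<Longrightarrow> f z = par q z" and q: "cmod q < 1" "q \<noteq> 0" and self: "disc_self_map f"
  shows "translation_number f = 2 * q / (1 - q)"
proof -
  let ?g = "half_plane_map 1 \<circ> f \<circ> inv_into unit_disc (half_plane_map 1)"
  have g: "?g w = w + 2 * q / (1 - q)" if w: "0 < Re w" for w
  proof -
    let ?z = "inv_into unit_disc cayley w"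
    have im: "w \<in> cayley ` unit_disc"
      using cayley_surj[OF w] by (metis imageI)
    have z: "?z \<in> unit_disc" "cayley ?z = w"
      by (rule inv_into_into[OF im], rule f_inv_into_f[OF im])
    have "?g w = cayley (f ?z)" by (simp add: half_plane_map_1)
    also have "\<dots> = w + 2 * q / (1 - q)"
      using cayley_par[OF q(1) z(1)] by (simp only: f[OF z(1)] z(2))
    finally show ?thesis .
  qed
  have "(\<exists>\<zeta>. parabolic_at f \<zeta> \<and> (\<forall>w. 0 < Re w \<longrightarrow>
      (half_plane_map \<zeta> \<circ> f \<circ> inv_into unit_disc (half_plane_map \<zeta>)) w = w + t))
    \<longleftrightarrow> t = 2 * q / (1 - q)" for t
  proof -
    have "(\<forall>w. 0 < Re w \<longrightarrow> ?g w = w + t) \<longleftrightarrow> t = 2 * q / (1 - q)"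
    proof
      assume "\<forall>w. 0 < Re w \<longrightarrow> ?g w = w + t"
      then have "0 < Re 1 \<longrightarrow> ?g 1 = 1 + t" by (rule spec)
      then have "?g 1 = 1 + t" by (rule mp) simp
      moreover have "?g 1 = 1 + 2 * q / (1 - q)" by (rule g) simp
      ultimately have "1 + t = 1 + 2 * q / (1 - q)" by (rule trans[OF sym])
      then show "t = 2 * q / (1 - q)" by (rule add_left_imp_eq)
    next
      assume t: "t = 2 * q / (1 - q)"
      show "\<forall>w. 0 < Re w \<longrightarrow> ?g w = w + t"
        unfolding t by (intro allI impI) (rule g)
    qed
    moreover have "parabolic_at f \<zeta> \<longleftrightarrow> \<zeta> = 1" for \<zeta>
      by (rule parabolic_at_par_iff[OF f q self])
    ultimately show ?thesis by (simp only: simp_thms)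
  qed
  then show ?thesis
    by (simp add: translation_number_def)
qed

lemma par_of_translation:
  assumes f: "disc_self_map f" and t: "0 < Re t"
    and translation: "\<And>z. z \<in> unit_disc \<Longrightarrow> cayley (f z) = cayley z + t"
  obtains q where "cmod q < 1" "q \<noteq> 0" "\<And>z. z \<in> unit_disc \<Longrightarrow> f z = par q z"
proof -
  \<comment> \<open>Solves 2 q / (1 - q) = t; since Re t > 0, t is closer to 0 than to -2, whence
    |q| < 1.\<close>
  define q where "q = t / (2 + t)"
  have t2: "2 + t \<noteq> 0" "t \<noteq> 0" using t by (auto simp: complex_eq_iff)
  have "cmod t < cmod (2 + t)"
  proof (rule power_less_imp_less_base)
    show "(cmod t)\<^sup>2 < (cmod (2 + t))\<^sup>2"
      unfolding cmod_power2 using t by (simp add: power2_eq_square algebra_simps)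
  qed simp
  then have q: "cmod q < 1"
    using t2 by (simp add: q_def norm_divide divide_less_eq)
  have "1 - q = 2 / (2 + t)" using t2 by (simp add: q_def field_simps)
  then have qt: "2 * q / (1 - q) = t" using t2 by (simp add: q_def)
  have eq: "f z = par q z" if z: "z \<in> unit_disc" for z
  proof -
    have "f z \<in> unit_disc" using f z unfolding disc_self_map_def by blast
    then have "f z \<noteq> 1" by auto
    moreover have "cayley (f z) = cayley (par q z)"
      using translation[OF z] cayley_par[OF q z] qt by simp
    ultimately show ?thesis
      using cayley_inject par_ne_1[OF q z] by blast
  qed
  have "q \<noteq> 0" using t2 by (simp add: q_def)
  then show ?thesis by (rule that[OF q _ eq])
qed

section \<open>From the common fixed point 1 to the translation model\<close>

theorem theorem3p5:
  fixes a0 a1 b p c t t' :: complex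
    and \<psi> \<phi> \<psi>p \<phi>p \<psi>' \<phi>' :: "complex \<Rightarrow> complex"
  assumes a0: "a0 \<in> unit_disc"
    and psi: "\<psi> = (\<lambda>z. b / (1 - a0 * z))"
    and phi: "\<phi> = (\<lambda>z. a0 + a1 * z / (1 - a0 * z))"
    and self_map: "disc_self_map \<phi>"
    and p: "p \<in> unit_disc - {0}"
    and c: "cmod c = 1"
    and phi_p: "\<phi>p = (\<lambda>z. cnj p / p * ((p - z) / (1 - cnj p * z)))"
    and psi_p: "\<psi>p = (\<lambda>z. c * (complex_of_real (sqrt (1 - (cmod p)\<^sup>2)) / (1 - cnj p * z)))"
    and psi': "\<psi>' = (\<lambda>z. \<psi>p z * \<psi> (\<phi>p z))"
    and phi': "\<phi>' = \<phi> \<circ> \<phi>p"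
    and not_aut: "\<not> disc_automorphism \<phi>'"
    and fix_phi: "\<phi> 1 = 1"
    and fix_phi_p: "\<phi>p 1 = 1"
    and t: "t = translation_number \<phi>"
    and t': "t' = translation_number \<phi>p"
  shows "parabolic \<phi> \<and> parabolic \<phi>p \<and> parabolic \<phi>' \<and>
    H2_spectral_radius (weighted_comp \<psi>' \<phi>') =
      cmod (\<psi> 0 * complex_of_real (sqrt (1 - (cmod p)\<^sup>2)) * (2 + t) / (2 * (1 - cnj p))) \<and>
    H2_spectrum (weighted_comp \<psi>' \<phi>') =
      {c * (\<psi> 0 * complex_of_real (sqrt (1 - (cmod p)\<^sup>2)) * (2 + t) / (2 * (1 - cnj p)))
          * exp (- (complex_of_real s * (t + t'))) | s :: real. s \<ge> 0} \<union> {0}"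
proof -
  have a0': "cmod a0 < 1" "1 - a0 \<noteq> 0" using a0 by auto
  have "cmod (cnj p) < 1" using p by simp
  then have p': "cmod (cnj p) < 1" "cnj p \<noteq> 0" "p \<noteq> 0" "1 - cnj p \<noteq> 0" "1 - p \<noteq> 0"
    using p by auto
  have phi_par: "\<phi> z = par a0 z" if "z \<in> unit_disc" for z
  proof -
    have nz: "1 - a0 * z \<noteq> 0" using one_minus_mult_nonzero[of a0 z] a0' that by simp
    have a1: "a1 = (1 - a0) * (1 - a0)"
      using fix_phi a0'(2) by (simp add: phi field_simps)
    have "\<phi> z = (a0 * (1 - a0 * z) + (1 - a0) * (1 - a0) * z) / (1 - a0 * z)"
      using nz by (simp add: phi a1 add_divide_distrib)
    also have "\<dots> = par a0 z"
      by (simp add: par_def algebra_simps)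
    finally show ?thesis .
  qed
  \<comment> \<open>Fixing 1 says that Re p equals |p|^2. This brings \<open>\<phi>p\<close> into
    the form \<open>par (cnj p)\<close> and makes its translation imaginary.\<close>
  have pp: "cnj p * (p - 1) = p * (1 - cnj p)"
    using fix_phi_p p' by (simp add: phi_p field_simps)
  have phi_p_par: "\<phi>p z = par (cnj p) z" for z
  proof -
    have "cnj p / p * (p - z) = cnj p + (1 - 2 * cnj p) * z"
    proof -
      have "cnj p * (p - z) = p * (cnj p + (1 - 2 * cnj p) * z)"
        using pp by algebra
      then show ?thesis using p' by (simp add: field_simps)
    qed
    moreover have "\<phi>p z = (cnj p / p * (p - z)) / (1 - cnj p * z)"
      by (simp add: phi_p)
    ultimately show ?thesis by (simp only: par_def)
  qed
  define \<tau> \<tau>' where "\<tau> = 2 * a0 / (1 - a0)" and "\<tau>' = 2 * cnj p / (1 - cnj p)"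
  have "\<tau>' + cnj \<tau>' = 0"
  proof -
    have "\<tau>' + cnj \<tau>' = 2 * (cnj p * (1 - p) + p * (1 - cnj p)) / ((1 - cnj p) * (1 - p))"
      using p' by (simp add: \<tau>'_def add_frac_eq algebra_simps)
    also have "cnj p * (1 - p) + p * (1 - cnj p) = 0" using pp by algebra
    finally show ?thesis by simp
  qed
  then have Re_\<tau>': "Re \<tau>' = 0" by (simp add: complex_eq_iff)
  have Re_\<tau>: "0 \<le> Re \<tau>"
    unfolding \<tau>_def by (rule Re_translation_nonneg[OF phi_par a0'(1) self_map])
  have self_p: "disc_self_map \<phi>p"
    by (rule disc_self_map_par[OF phi_p_par p'(1)]) (use Re_\<tau>' in \<open>simp add: \<tau>'_def\<close>)
  have maps: "\<phi>p z \<in> unit_disc" "\<phi>' z \<in> unit_disc" if "z \<in> unit_disc" for z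
    using self_map self_p that unfolding disc_self_map_def phi' comp_def by blast+
  have self': "disc_self_map \<phi>'"
    using self_map self_p maps holomorphic_on_compose_gen[of \<phi>p unit_disc \<phi> unit_disc]
    by (auto simp: disc_self_map_def phi')
  have trans: "cayley (\<phi>' z) = cayley z + (\<tau> + \<tau>')" if "z \<in> unit_disc" for z
  proof -
    have "cayley (\<phi>' z) = cayley (\<phi>p z) + \<tau>"
      unfolding phi' comp_apply phi_par[OF maps(1)[OF that]] \<tau>_def
      by (rule cayley_par[OF a0'(1) maps(1)[OF that]])
    also have "cayley (\<phi>p z) = cayley z + \<tau>'"
      unfolding phi_p_par \<tau>'_def by (rule cayley_par[OF p'(1) that])
    finally show ?thesis by (simp add: add_ac)
  qed
  \<comment> \<open>Were Re \<tau> zero, the composed map would be an imaginary translation of the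
    half-plane, hence an automorphism.\<close>
  have pos: "0 < Re \<tau>"
    using Re_\<tau> disc_automorphism_if_imaginary_translation[OF self' _ trans] Re_\<tau>' not_aut
    by (cases "Re \<tau> = 0") auto
  then have a0_nz: "a0 \<noteq> 0" by (auto simp: \<tau>_def)
  have t_eq: "t = \<tau>" unfolding t \<tau>_def by (rule translation_number_par[OF phi_par a0'(1) a0_nz self_map])
  have t'_eq: "t' = \<tau>'" unfolding t' \<tau>'_def by (rule translation_number_par[OF phi_p_par p'(1,2) self_p])
  have "0 < Re (\<tau> + \<tau>')" using pos Re_\<tau>' by simp
  obtain q where q: "cmod q < 1" "q \<noteq> 0" "\<And>z. z \<in> unit_disc \<Longrightarrow> \<phi>' z = par q z"
    using par_of_translation[OF self' \<open>0 < Re (\<tau> + \<tau>')\<close> trans] by blast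
  have par: "parabolic \<phi>" "parabolic \<phi>p" "parabolic \<phi>'"
    by (rule parabolic_if_par[OF phi_par a0'(1) a0_nz self_map], assumption)
       (rule parabolic_if_par[OF phi_p_par p'(1,2) self_p], rule parabolic_if_par[OF q(3,1,2) self'])
  define D where "D = \<psi> 0 * complex_of_real (sqrt (1 - (cmod p)\<^sup>2)) * (2 + t) / (2 * (1 - cnj p))"
  \<comment> \<open>With \<psi> 0 = b this puts the stated constant into the form that the weight
    computation produces.\<close>
  have "2 + t = 2 / (1 - a0)" using a0' by (simp add: t_eq \<tau>_def field_simps)
  moreover have "x * (2 / u) / (2 * v) = x / (u * v)" for x u v :: complex
    by simp
  ultimately have D: "D = b * complex_of_real (sqrt (1 - (cmod p)\<^sup>2)) / ((1 - a0) * (1 - cnj p))"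
    by (simp only: D_def psi mult_zero_right diff_zero div_by_1)
  interpret parabolic_weighted_comp \<psi>' \<phi>' "c * D" "t + t'"
  proof
    show "0 < Re (t + t')" using pos Re_\<tau>' by (simp add: t_eq t'_eq)
    fix z assume z: "z \<in> unit_disc"
    show "\<phi>' z \<in> unit_disc" using maps z by blast
    show "cayley (\<phi>' z) = cayley z + (t + t')" using trans[OF z] by (simp add: t_eq t'_eq)
    have le: "cmod (\<phi>p z) \<le> 1" "cmod z \<le> 1" "z \<noteq> 1"
      using maps(1)[OF z] z by (auto simp: dist_norm)
    have nz: "1 - a0 * \<phi>p z \<noteq> 0" "1 - cnj p * z \<noteq> 0" "1 - z \<noteq> 0"
      using one_minus_mult_nonzero[OF a0'(1) le(1)] one_minus_mult_nonzero[OF p'(1) le(2)] le(3) by auto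
    have "1 - \<phi>' z = (1 - a0) * (1 - \<phi>p z) / (1 - a0 * \<phi>p z)"
      using nz one_minus_par[of a0 "\<phi>p z"] by (simp add: phi' phi_par[OF maps(1)[OF z]])
    \<comment> \<open>Together with the previous factorisation, the denominators are those of \<psi>
      at \<open>\<phi>p z\<close> and of \<open>\<psi>p\<close> at z, so the weight is a constant
      times \<open>(1 - \<phi>' z) / (1 - z)\<close>.\<close>
    also have "1 - \<phi>p z = (1 - cnj p) * (1 - z) / (1 - cnj p * z)"
      using nz by (simp add: phi_p_par one_minus_par)
    finally show "\<psi>' z = c * D * (1 - \<phi>' z) / (1 - z)"
      using nz a0' p' by (simp add: D psi' psi_p psi)
  qed
  \<comment> \<open>|c| = 1 removes c from the spectral radius, while it remains as a rotation of
    the spectral curve.\<close>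
  show ?thesis
    unfolding D_def[symmetric] using par spectrum spectral_radius c by (simp add: norm_mult)
qed

end
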